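(* Fix a prime number $K\ge 2$ and suppose $d\ge 1$. Then for every $n\ge1$ and every observable $A\in M_K(\mathbb{C})^{\otimes n}$ of degree at most $d$ (in the Heisenberg--Weyl sense), $$\|\widehat{A}\|_{\frac{2d}{d+1}}:=\Big(\sum_{\vec\ell,\vec m\in\mathbb{Z}_K^n}|\widehat{A}(\vec\ell,\vec m)|^{\frac{2d}{d+1}}\Big)^{\frac{d+1}{2d}}\le C(d,K)\,\|A\|_{\mathrm{op}}$$ with a constant $C(d,K)\le (K+1)^d\,\mathrm{BH}_{\Omega_K}^{\le d}$.
   Context: An observable is a Hermitian operator; $\|\cdot\|_{\mathrm{op}}$ is the operator norm. $\mathbb{Z}_K=\{0,1,\dots,K-1\}$ is the additive cyclic group of order $K$, $\omega=e^{2\pi i/K}$, and $\Omega_K=\{1,\omega,\dots,\omega^{K-1}\}$. Heisenberg--Weyl basis: on $\mathbb{C}^K$ with canonical basis $|j\rangle$, $j\in\mathbb{Z}_K$, let $Z|j\rangle=\omega^j|j\rangle$ and $X|j\rangle=|j+1\rangle$ (index mod $K$). The matrices $X^\ell Z^m$, $\ell,m\in\mathbb{Z}_K$, form a basis of $M_K(\mathbb{C})$. Every $A\in M_K(\mathbb{C})^{\otimes n}$ has a unique expansion $$A=\sum_{\vec\ell,\vec m\in\mathbb{Z}_K^n}\widehat{A}(\vec\ell,\vec m)\,X^{\ell_1}Z^{m_1}\otimes\cdots\otimes X^{\ell_n}Z^{m_n}.$$ $A$ is of degree at most $d$ if $\widehat{A}(\vec\ell,\vec m)=0$ whenever $\sum_{j=1}^n(\ell_j+m_j)>d$,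 where $0\le\ell_j,m_j\le K-1$ are taken as integers. Cyclic constant: every $f:\Omega_K^N\to\mathbb{C}$ has a unique expansion $f(z)=\sum_{\alpha}\widehat f(\alpha)z^\alpha$ over $\alpha\in\{0,\dots,K-1\}^N$; $f$ is of degree at most $d$ if $\widehat f(\alpha)=0$ whenever $|\alpha|=\sum_j\alpha_j>d$. $\mathrm{BH}_{\Omega_K}^{\le d}$ denotes the best constant $C$ (known to be finite) such that $\big(\sum_\alpha|\widehat f(\alpha)|^{\frac{2d}{d+1}}\big)^{\frac{d+1}{2d}}\le C\sup_{z\in\Omega_K^N}|f(z)|$ for all $N\ge1$ and all $f:\Omega_K^N\to\mathbb{C}$ of degree at most $d$. *)

theory Defs
  imports
    "Jordan_Normal_Form.Schur_Decomposition"
    "HOL-Analysis.L2_Norm"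
    "HOL-Library.Extended_Nonnegative_Real"
    "HOL-Computational_Algebra.Primes"
    "HOL-Number_Theory.Cong"
begin

definition omega :: "nat \<Rightarrow> complex"
  where "omega K = cis (2 * pi / real K)"

definition Omega :: "nat \<Rightarrow> complex set"
  where "Omega K = (\<lambda>j. omega K ^ j) ` {..<K}"

text \<open>Multi-indices in \<open>{0, \<dots>, K - 1}\<^sup>n\<close>; positions run from \<open>0\<close> to \<open>n - 1\<close>.\<close>

definition multi_idx :: "nat \<Rightarrow> nat \<Rightarrow> (nat \<Rightarrow> nat) set"
  where "multi_idx K n = {..<n} \<rightarrow>\<^sub>E {..<K}"

section \<open>Functions on powers of the cyclic group\<close>

definition Omega_pow :: "nat \<Rightarrow> nat \<Rightarrow> (nat \<Rightarrow> complex) set"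
  where "Omega_pow K N = {..<N} \<rightarrow>\<^sub>E Omega K"

text \<open>Coefficient functions are zero off the index set, so that an expansion is unique as a
  function; a function \<open>f\<close> on \<open>Omega_pow K N\<close> is a total function whose values elsewhere are ignored.\<close>

definition cyclic_expansion ::
    "nat \<Rightarrow> nat \<Rightarrow> ((nat \<Rightarrow> complex) \<Rightarrow> complex) \<Rightarrow> ((nat \<Rightarrow> nat) \<Rightarrow> complex) \<Rightarrow> bool"
  where "cyclic_expansion K N f c \<longleftrightarrow>
    (\<forall>\<alpha>. \<alpha> \<notin> multi_idx K N \<longrightarrow> c \<alpha> = 0) \<and>
    (\<forall>z\<in>Omega_pow K N. f z = (\<Sum>\<alpha>\<in>multi_idx K N. c \<alpha> * (\<Prod>j<N. z j ^ \<alpha> j)))"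

definition cyclic_coeff ::
    "nat \<Rightarrow> nat \<Rightarrow> ((nat \<Rightarrow> complex) \<Rightarrow> complex) \<Rightarrow> (nat \<Rightarrow> nat) \<Rightarrow> complex"
  where "cyclic_coeff K N f = (THE c. cyclic_expansion K N f c)"

definition cyclic_degree_le :: "nat \<Rightarrow> nat \<Rightarrow> nat \<Rightarrow> ((nat \<Rightarrow> complex) \<Rightarrow> complex) \<Rightarrow> bool"
  where "cyclic_degree_le K N d f \<longleftrightarrow>
    (\<forall>\<alpha>\<in>multi_idx K N. (\<Sum>j<N. \<alpha> j) > d \<longrightarrow> cyclic_coeff K N f \<alpha> = 0)"

text \<open>The \<open>L\<^sup>p\<close> norm of a finite family, for the exponent \<open>p = 2d / (d + 1)\<close>.\<close>

definition BH_norm :: "nat \<Rightarrow> 'i set \<Rightarrow> ('i \<Rightarrow> complex) \<Rightarrow> real"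
  where "BH_norm d I a =
    (\<Sum>i\<in>I. cmod (a i) powr (2 * real d / (real d + 1))) powr ((real d + 1) / (2 * real d))"

definition BH_bound :: "nat \<Rightarrow> nat \<Rightarrow> real \<Rightarrow> bool"
  where "BH_bound K d C \<longleftrightarrow>
    (\<forall>N\<ge>1. \<forall>f. cyclic_degree_le K N d f \<longrightarrow>
      BH_norm d (multi_idx K N) (cyclic_coeff K N f) \<le> C * (SUP z\<in>Omega_pow K N. cmod (f z)))"

text \<open>The best constant, as a value in \<open>[0, \<infinity>]\<close>: the infimum over the empty set would be \<open>\<infinity>\<close>,
  whereas a real-valued infimum would be unspecified without a proof that some constant exists.
  Every admissible \<open>C\<close> is at least \<open>1\<close> when \<open>K \<ge> 1\<close> (take \<open>f = 1\<close>), so \<open>ennreal\<close> truncates nothing.\<close>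

definition BH_cyclic :: "nat \<Rightarrow> nat \<Rightarrow> ennreal"
  where "BH_cyclic K d = (INF C\<in>{C. BH_bound K d C}. ennreal C)"

section \<open>Matrices and the Heisenberg--Weyl basis\<close>

definition shift_mat :: "nat \<Rightarrow> complex mat"
  where "shift_mat K = mat K K (\<lambda>(i, j). if i = (j + 1) mod K then 1 else 0)"

definition clock_mat :: "nat \<Rightarrow> complex mat"
  where "clock_mat K = mat K K (\<lambda>(i, j). if i = j then omega K ^ j else 0)"

definition kronecker :: "complex mat \<Rightarrow> complex mat \<Rightarrow> complex mat"
  where "kronecker A B = mat (dim_row A * dim_row B) (dim_col A * dim_col B)
    (\<lambda>(i, j). A $$ (i div dim_row B, j div dim_col B) * B $$ (i mod dim_row B, j mod dim_col B))"

text \<open>\<open>tensor_upto M n\<close> is \<open>M 0 \<otimes> \<dots> \<otimes> M (n - 1)\<close>. The algebra \<open>M\<^sub>K(\<complex>)\<^sup>\<otimes>\<^sup>n\<close> is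
  \<open>carrier_mat (K ^ n) (K ^ n)\<close> under this Kronecker product.\<close>

primrec tensor_upto :: "(nat \<Rightarrow> complex mat) \<Rightarrow> nat \<Rightarrow> complex mat"
  where
    "tensor_upto M 0 = 1\<^sub>m 1"
  | "tensor_upto M (Suc n) = kronecker (tensor_upto M n) (M n)"

definition hw_basis :: "nat \<Rightarrow> nat \<Rightarrow> (nat \<Rightarrow> nat) \<Rightarrow> (nat \<Rightarrow> nat) \<Rightarrow> complex mat"
  where "hw_basis K n l m = tensor_upto (\<lambda>j. shift_mat K ^\<^sub>m l j * clock_mat K ^\<^sub>m m j) n"

definition hw_expansion ::
    "nat \<Rightarrow> nat \<Rightarrow> complex mat \<Rightarrow> ((nat \<Rightarrow> nat) \<times> (nat \<Rightarrow> nat) \<Rightarrow> complex) \<Rightarrow> bool"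
  where "hw_expansion K n A c \<longleftrightarrow>
    (\<forall>lm. lm \<notin> multi_idx K n \<times> multi_idx K n \<longrightarrow> c lm = 0) \<and>
    A = mat (K ^ n) (K ^ n)
      (\<lambda>ij. \<Sum>(l, m)\<in>multi_idx K n \<times> multi_idx K n. c (l, m) * hw_basis K n l m $$ ij)"

definition hw_coeff :: "nat \<Rightarrow> nat \<Rightarrow> complex mat \<Rightarrow> (nat \<Rightarrow> nat) \<times> (nat \<Rightarrow> nat) \<Rightarrow> complex"
  where "hw_coeff K n A = (THE c. hw_expansion K n A c)"

definition hw_degree_le :: "nat \<Rightarrow> nat \<Rightarrow> nat \<Rightarrow> complex mat \<Rightarrow> bool"
  where "hw_degree_le K n d A \<longleftrightarrow>
    (\<forall>l\<in>multi_idx K n. \<forall>m\<in>multi_idx K n. (\<Sum>j<n. l j + m j) > d \<longrightarrow> hw_coeff K n A (l, m) = 0)"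

definition observable :: "nat \<Rightarrow> nat \<Rightarrow> complex mat \<Rightarrow> bool"
  where "observable K n A \<longleftrightarrow> A \<in> carrier_mat (K ^ n) (K ^ n) \<and> mat_adjoint A = A"

definition vec_l2 :: "complex vec \<Rightarrow> real"
  where "vec_l2 v = L2_set (\<lambda>i. cmod (v $ i)) {..<dim_vec v}"

definition op_norm :: "complex mat \<Rightarrow> real"
  where "op_norm A = (SUP v\<in>{v \<in> carrier_vec (dim_col A). vec_l2 v \<le> 1}. vec_l2 (A *\<^sub>v v))"

section \<open>Both expansions exist and are unique\<close>

lemma orthogonal_expansion:
  fixes e :: "'a \<Rightarrow> 'b \<Rightarrow> complex" and q :: complex
  assumes fin: "finite I" "finite J" and q: "q \<noteq> 0"
    and o1: "\<And>a b. a \<in> I \<Longrightarrow> b \<in> I \<Longrightarrow> (\<Sum>z\<in>J. e a z * cnj (e b z)) = (if a = b then q else 0)"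
    and o2: "\<And>z w. z \<in> J \<Longrightarrow> w \<in> J \<Longrightarrow> (\<Sum>a\<in>I. e a z * cnj (e a w)) = (if z = w then q else 0)"
  shows "\<exists>!c. (\<forall>a. a \<notin> I \<longrightarrow> c a = 0) \<and> (\<forall>z\<in>J. g z = (\<Sum>a\<in>I. c a * e a z))"
proof -
  define c where "c = (\<lambda>a. if a \<in> I then (\<Sum>w\<in>J. g w * cnj (e a w)) / q else 0)"
  have ex: "g z = (\<Sum>a\<in>I. c a * e a z)" if z: "z \<in> J" for z
  proof -
    have "(\<Sum>a\<in>I. c a * e a z) = (\<Sum>a\<in>I. \<Sum>w\<in>J. g w / q * (e a z * cnj (e a w)))"
    proof (rule sum.cong[OF refl])
      fix a assume "a \<in> I"
      then have "c a = (\<Sum>w\<in>J. g w * cnj (e a w) / q)" by (simp add: c_def sum_divide_distrib)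
      then show "c a * e a z = (\<Sum>w\<in>J. g w / q * (e a z * cnj (e a w)))"
        by (simp add: sum_distrib_right) (simp add: mult_ac)
    qed
    also have "\<dots> = (\<Sum>w\<in>J. g w / q * (\<Sum>a\<in>I. e a z * cnj (e a w)))"
      by (subst sum.swap) (simp add: sum_distrib_left)
    also have "\<dots> = (\<Sum>w\<in>J. if z = w then g w else 0)"
      using q z by (intro sum.cong refl) (auto simp: o2)
    also have "\<dots> = g z" using z fin by simp
    finally show ?thesis by simp
  qed
  show ?thesis
  proof (rule ex1I[of _ c])
    show "(\<forall>a. a \<notin> I \<longrightarrow> c a = 0) \<and> (\<forall>z\<in>J. g z = (\<Sum>a\<in>I. c a * e a z))"
    proof (intro conjI allI impI ballI)
      show "c a = 0" if "a \<notin> I" for a using that by (simp add: c_def)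
    qed (rule ex)
  next
    fix c' assume c': "(\<forall>a. a \<notin> I \<longrightarrow> c' a = 0) \<and> (\<forall>z\<in>J. g z = (\<Sum>a\<in>I. c' a * e a z))"
    show "c' = c"
    proof
      fix b
      show "c' b = c b"
      proof (cases "b \<in> I")
        case True
        have "(\<Sum>w\<in>J. g w * cnj (e b w)) = (\<Sum>w\<in>J. \<Sum>a\<in>I. c' a * (e a w * cnj (e b w)))"
          using c' by (intro sum.cong refl) (simp add: sum_distrib_right mult.assoc)
        also have "\<dots> = (\<Sum>a\<in>I. c' a * (\<Sum>w\<in>J. e a w * cnj (e b w)))"
          by (subst sum.swap) (simp add: sum_distrib_left)
        also have "\<dots> = (\<Sum>a\<in>I. if a = b then c' a * q else 0)"
          using True by (intro sum.cong refl) (auto simp: o1)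
        also have "\<dots> = c' b * q" using True fin by simp
        finally show ?thesis using True q by (simp add: c_def)
      next
        case False
        then show ?thesis using c' by (simp add: c_def)
      qed
    qed
  qed
qed

lemma omega_pow_K: "K > 0 \<Longrightarrow> omega K ^ K = 1"
  by (simp add: omega_def DeMoivre)

lemma omega_nz [simp]: "omega K \<noteq> 0"
  by (simp add: omega_def)

lemma inj_omega_pow:
  assumes "K > 0"
  shows "inj_on (\<lambda>j. omega K ^ j) {..<K}"
proof -
  have "omega K ^ j = cis (2 * pi * real j / real K)" for j
    unfolding omega_def DeMoivre by (rule arg_cong[of _ _ cis]) simp
  then show ?thesis
    using bij_betw_imp_inj_on[OF bij_betw_roots_unity[OF assms]] by simp
qed

lemma cnj_omega_pow: "cnj (omega K ^ b) = inverse (omega K ^ b)"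
  unfolding omega_def DeMoivre cis_cnj cis_inverse ..

lemma sum_omega:
  assumes K: "K > 0" and "a < K" "b < K"
  shows "(\<Sum>m<K. omega K ^ (a * m) * cnj (omega K ^ (b * m))) = (if a = b then of_nat K else 0)"
proof -
  define x where "x = omega K ^ a * cnj (omega K ^ b)"
  have s: "(\<Sum>m<K. omega K ^ (a * m) * cnj (omega K ^ (b * m))) = (\<Sum>m<K. x ^ m)"
    by (simp add: x_def power_mult power_mult_distrib)
  show ?thesis
  proof (cases "a = b")
    case True
    then have "x = 1" by (simp add: x_def cnj_omega_pow del: complex_cnj_power)
    then show ?thesis using True s by simp
  next
    case False
    have "x \<noteq> 1"
    proof
      assume "x = 1"
      then have "omega K ^ a = omega K ^ b"
        unfolding x_def cnj_omega_pow by (simp add: divide_inverse[symmetric])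
      then show False using inj_onD[OF inj_omega_pow[OF K]] assms False by auto
    qed
    moreover have "x ^ K = 1"
    proof -
      have "x ^ K = (omega K ^ K) ^ a * cnj ((omega K ^ K) ^ b)"
        unfolding x_def complex_cnj_power power_mult_distrib
        by (simp only: mult.commute[of K] flip: power_mult)
      then show ?thesis by (simp add: omega_pow_K[OF K])
    qed
    ultimately show ?thesis using False s by (simp add: sum_gp_strict)
  qed
qed

lemma finite_Omega [simp]: "finite (Omega K)"
  by (simp add: Omega_def)

lemma finite_multi_idx [simp]: "finite (multi_idx K n)"
  by (simp add: multi_idx_def finite_PiE)

lemma finite_Omega_pow [simp]: "finite (Omega_pow K n)"
  by (simp add: Omega_pow_def finite_PiE)

lemma prod_if_all:
  fixes k :: complex
  shows "(\<Prod>j<N. if P j then k else 0) = (if \<forall>j<N. P j then k ^ N else 0)"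
  by (induction N) (auto simp: less_Suc_eq)

lemma PiE_eq_iff_lt: "x \<in> {..<N} \<rightarrow>\<^sub>E B \<Longrightarrow> y \<in> {..<N} \<rightarrow>\<^sub>E B \<Longrightarrow> (\<forall>j<N. x j = y j) \<longleftrightarrow> x = y" for N :: nat
  by (auto intro: PiE_ext)

theorem cyclic_expansion_unique:
  assumes K: "K > 0"
  shows "\<exists>!c. cyclic_expansion K N f c"
  unfolding cyclic_expansion_def
proof (rule orthogonal_expansion[where q = "of_nat K ^ N"])
  fix \<alpha> \<beta> assume ab: "\<alpha> \<in> multi_idx K N" "\<beta> \<in> multi_idx K N"
  have "(\<Sum>z\<in>Omega_pow K N. (\<Prod>j<N. z j ^ \<alpha> j) * cnj (\<Prod>j<N. z j ^ \<beta> j))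
      = (\<Sum>z\<in>Omega_pow K N. \<Prod>j<N. z j ^ \<alpha> j * cnj (z j ^ \<beta> j))"
    by (simp add: prod.distrib)
  also have "\<dots> = (\<Prod>j<N. \<Sum>w\<in>Omega K. w ^ \<alpha> j * cnj (w ^ \<beta> j))"
    unfolding Omega_pow_def by (rule prod_sum_PiE[symmetric]) auto
  also have "\<dots> = (\<Prod>j<N. if \<alpha> j = \<beta> j then of_nat K else 0)"
  proof (rule prod.cong[OF refl])
    fix j assume "j \<in> {..<N}"
    then have j: "\<alpha> j < K" "\<beta> j < K" using ab by (auto simp: multi_idx_def PiE_def Pi_def)
    have "(\<Sum>w\<in>Omega K. w ^ \<alpha> j * cnj (w ^ \<beta> j))
        = (\<Sum>i<K. omega K ^ (\<alpha> j * i) * cnj (omega K ^ (\<beta> j * i)))"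
      unfolding Omega_def
      by (subst sum.reindex[OF inj_omega_pow[OF K]]) (simp only: o_def mult.commute flip: power_mult)
    then show "(\<Sum>w\<in>Omega K. w ^ \<alpha> j * cnj (w ^ \<beta> j)) = (if \<alpha> j = \<beta> j then of_nat K else 0)"
      using sum_omega[OF K j] by simp
  qed
  also have "\<dots> = (if \<alpha> = \<beta> then of_nat K ^ N else 0)"
    using ab by (simp only: prod_if_all multi_idx_def PiE_eq_iff_lt)
  finally show "(\<Sum>z\<in>Omega_pow K N. (\<Prod>j<N. z j ^ \<alpha> j) * cnj (\<Prod>j<N. z j ^ \<beta> j))
      = (if \<alpha> = \<beta> then of_nat K ^ N else 0)" .
next
  fix z w assume zw: "z \<in> Omega_pow K N" "w \<in> Omega_pow K N"
  have "(\<Sum>\<alpha>\<in>multi_idx K N. (\<Prod>j<N. z j ^ \<alpha> j) * cnj (\<Prod>j<N. w j ^ \<alpha> j))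
      = (\<Sum>\<alpha>\<in>multi_idx K N. \<Prod>j<N. z j ^ \<alpha> j * cnj (w j ^ \<alpha> j))"
    by (simp add: prod.distrib)
  also have "\<dots> = (\<Prod>j<N. \<Sum>a<K. z j ^ a * cnj (w j ^ a))"
    unfolding multi_idx_def by (rule prod_sum_PiE[symmetric]) auto
  also have "\<dots> = (\<Prod>j<N. if z j = w j then of_nat K else 0)"
  proof (rule prod.cong[OF refl])
    fix j assume "j \<in> {..<N}"
    then have "z j \<in> Omega K" "w j \<in> Omega K" using zw by (auto simp: Omega_pow_def PiE_def Pi_def)
    then obtain a b where ab: "a < K" "b < K" "z j = omega K ^ a" "w j = omega K ^ b"
      by (auto simp: Omega_def)
    have "z j = w j \<longleftrightarrow> a = b"
      using ab inj_on_eq_iff[OF inj_omega_pow[OF K], of a b] by simp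
    then show "(\<Sum>a<K. z j ^ a * cnj (w j ^ a)) = (if z j = w j then of_nat K else 0)"
      using sum_omega[OF K ab(1,2)] by (simp add: ab(3,4) power_mult)
  qed
  also have "\<dots> = (if z = w then of_nat K ^ N else 0)"
    using zw by (simp only: prod_if_all Omega_pow_def PiE_eq_iff_lt)
  finally show "(\<Sum>\<alpha>\<in>multi_idx K N. (\<Prod>j<N. z j ^ \<alpha> j) * cnj (\<Prod>j<N. w j ^ \<alpha> j))
      = (if z = w then of_nat K ^ N else 0)" .
qed (use K in auto)

lemma shift_clock_carrier [simp]:
  "shift_mat K \<in> carrier_mat K K" "clock_mat K \<in> carrier_mat K K"
  by (auto simp: shift_mat_def clock_mat_def)

lemma shift_clock_dim [simp]:
  "dim_row (shift_mat K) = K" "dim_col (shift_mat K) = K"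
  "dim_row (clock_mat K) = K" "dim_col (clock_mat K) = K"
  by (auto simp: shift_mat_def clock_mat_def)

lemma shift_pow:
  "shift_mat K ^\<^sub>m l = mat K K (\<lambda>(i, j). if i = (j + l) mod K then 1 else 0)"
proof (induction l)
  case 0
  show ?case by (rule eq_matI) auto
next
  case (Suc l)
  show ?case
  proof (rule eq_matI)
    fix i j assume "i < dim_row (mat K K (\<lambda>(i, j). if i = (j + Suc l) mod K then 1 else (0::complex)))"
      "j < dim_col (mat K K (\<lambda>(i, j). if i = (j + Suc l) mod K then 1 else (0::complex)))"
    then have ij: "i < K" "j < K" by auto
    have "(shift_mat K ^\<^sub>m Suc l) $$ (i, j)
        = (\<Sum>k<K. (if i = (k + l) mod K then 1 else 0) * (if k = (j + 1) mod K then 1 else 0))"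
      unfolding pow_mat.simps Suc.IH unfolding shift_mat_def
      using ij by (simp add: scalar_prod_def lessThan_atLeast0)
    also have "\<dots> = (\<Sum>k<K. if k = (j + 1) mod K then (if i = (k + l) mod K then 1 else 0) else 0)"
      by (intro sum.cong) auto
    also have "\<dots> = (if i = (j + Suc l) mod K then 1 else 0)"
      using ij by (simp add: mod_simps)
    finally show "(shift_mat K ^\<^sub>m Suc l) $$ (i, j)
        = mat K K (\<lambda>(i, j). if i = (j + Suc l) mod K then 1 else 0) $$ (i, j)" using ij by simp
  qed (simp_all add: Suc.IH)
qed

lemma clock_pow:
  "clock_mat K ^\<^sub>m m = mat K K (\<lambda>(i, j). if i = j then omega K ^ (j * m) else 0)"
proof (induction m)
  case 0
  show ?case by (rule eq_matI) auto
next
  case (Suc m)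
  show ?case
  proof (rule eq_matI)
    fix i j assume "i < dim_row (mat K K (\<lambda>(i, j). if i = j then omega K ^ (j * Suc m) else 0))"
      "j < dim_col (mat K K (\<lambda>(i, j). if i = j then omega K ^ (j * Suc m) else 0))"
    then have ij: "i < K" "j < K" by auto
    have "(clock_mat K ^\<^sub>m Suc m) $$ (i, j)
        = (\<Sum>k<K. (if i = k then omega K ^ (k * m) else 0) * (if k = j then omega K ^ j else 0))"
      unfolding pow_mat.simps Suc.IH unfolding clock_mat_def
      using ij by (simp add: scalar_prod_def lessThan_atLeast0)
    also have "\<dots> = (\<Sum>k<K. if k = j then (if i = j then omega K ^ (j * Suc m) else 0) else 0)"
      by (intro sum.cong) (auto simp: power_add)
    also have "\<dots> = (if i = j then omega K ^ (j * Suc m) else 0)"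
      using ij by simp
    finally show "(clock_mat K ^\<^sub>m Suc m) $$ (i, j)
        = mat K K (\<lambda>(i, j). if i = j then omega K ^ (j * Suc m) else 0) $$ (i, j)" using ij by simp
  qed (simp_all add: Suc.IH)
qed

lemma shift_clock_entry:
  assumes ij: "i < K" "j < K"
  shows "(shift_mat K ^\<^sub>m l * clock_mat K ^\<^sub>m m) $$ (i, j)
    = (if i = (j + l) mod K then omega K ^ (j * m) else 0)"
proof -
  have "(shift_mat K ^\<^sub>m l * clock_mat K ^\<^sub>m m) $$ (i, j)
      = (\<Sum>k<K. (if i = (k + l) mod K then 1 else 0) * (if k = j then omega K ^ (j * m) else 0))"
    using ij by (simp add: shift_pow clock_pow scalar_prod_def lessThan_atLeast0)
  also have "\<dots> = (\<Sum>k<K. if k = j then (if i = (j + l) mod K then omega K ^ (j * m) else 0) else 0)"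
    by (intro sum.cong) auto
  finally show ?thesis using ij by simp
qed

lemma shift_clock_prod_carrier [simp]:
  "shift_mat K ^\<^sub>m l * clock_mat K ^\<^sub>m m \<in> carrier_mat K K"
  by (metis mult_carrier_mat pow_carrier_mat shift_clock_carrier)

lemma hw_basis_carrier [simp]: "hw_basis K n l m \<in> carrier_mat (K ^ n) (K ^ n)"
proof (induction n)
  case (Suc n)
  note d = carrier_matD[OF Suc.IH] carrier_matD[OF shift_clock_prod_carrier[of K "l n" "m n"]]
  have "hw_basis K (Suc n) l m
      = kronecker (hw_basis K n l m) (shift_mat K ^\<^sub>m l n * clock_mat K ^\<^sub>m m n)"
    by (simp only: hw_basis_def tensor_upto.simps)
  then show ?case
    unfolding kronecker_def d by (simp only: mat_carrier power_Suc mult.commute)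
qed (simp add: hw_basis_def)

lemma hw_basis_entry_Suc:
  assumes "i < K ^ Suc n" "j < K ^ Suc n"
  shows "hw_basis K (Suc n) l m $$ (i, j) = hw_basis K n l m $$ (i div K, j div K)
    * (if i mod K = (j mod K + l n) mod K then omega K ^ (j mod K * m n) else 0)"
proof -
  have K: "0 < K" using assms by (cases K) auto
  have d: "dim_row (shift_mat K ^\<^sub>m l n * clock_mat K ^\<^sub>m m n) = K"
    "dim_col (shift_mat K ^\<^sub>m l n * clock_mat K ^\<^sub>m m n) = K"
    using shift_clock_prod_carrier[of K "l n" "m n"] by auto
  have d': "dim_row (hw_basis K n l m) = K ^ n" "dim_col (hw_basis K n l m) = K ^ n"
    by (rule carrier_matD[OF hw_basis_carrier])+
  have "hw_basis K (Suc n) l m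
      = kronecker (hw_basis K n l m) (shift_mat K ^\<^sub>m l n * clock_mat K ^\<^sub>m m n)"
    by (simp add: hw_basis_def)
  then have "hw_basis K (Suc n) l m $$ (i, j) = hw_basis K n l m $$ (i div K, j div K)
      * (shift_mat K ^\<^sub>m l n * clock_mat K ^\<^sub>m m n) $$ (i mod K, j mod K)"
    using assms by (simp add: kronecker_def d d' mult.commute del: index_mult_mat)
  then show ?thesis using K by (simp only: shift_clock_entry mod_less_divisor)
qed

lemma hw_basis_cong:
  "(\<And>k. k < n \<Longrightarrow> l k = l' k \<and> m k = m' k) \<Longrightarrow> hw_basis K n l m = hw_basis K n l' m'"
proof (induction n)
  case (Suc n)
  have "hw_basis K n l m = hw_basis K n l' m'" using Suc by simp
  then show ?case using Suc.prems[of n] by (simp add: hw_basis_def)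
qed (simp add: hw_basis_def)

lemma sum_div_mod:
  fixes g :: "nat \<Rightarrow> nat \<Rightarrow> complex"
  assumes K: "K > 0"
  shows "(\<Sum>i<M * K. g (i div K) (i mod K)) = (\<Sum>a<M. \<Sum>b<K. g a b)"
proof -
  have "(\<Sum>a<M. \<Sum>b<K. g a b) = (\<Sum>(a, b)\<in>{..<M} \<times> {..<K}. g a b)"
    by (rule sum.cartesian_product)
  also have "\<dots> = (\<Sum>i<M * K. g (i div K) (i mod K))"
  proof (rule sum.reindex_bij_witness[of _ "\<lambda>i. (i div K, i mod K)" "\<lambda>(a, b). a * K + b"])
    fix ab assume ab: "ab \<in> {..<M} \<times> {..<K}"
    obtain a b where [simp]: "ab = (a, b)" by (cases ab)
    have "a * K + b < Suc a * K" using ab by simp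
    also have "\<dots> \<le> M * K" using ab by (intro mult_right_mono) auto
    finally show "(case ab of (a, b) \<Rightarrow> a * K + b) \<in> {..<M * K}" by simp
  qed (use K in \<open>auto simp: less_mult_imp_div_less\<close>)
  finally show ?thesis by simp
qed

lemma sum_PiE_Suc:
  fixes g :: "(nat \<Rightarrow> nat) \<Rightarrow> complex"
  shows "(\<Sum>p\<in>multi_idx K (Suc n). g p) = (\<Sum>p\<in>multi_idx K n. \<Sum>x<K. g (p(n := x)))"
proof -
  have "(\<Sum>p\<in>multi_idx K (Suc n). g p)
      = (\<Sum>p\<in>(\<lambda>(y, h). h(n := y)) ` ({..<K} \<times> multi_idx K n). g p)"
    by (simp add: multi_idx_def lessThan_Suc PiE_insert_eq)
  also have "\<dots> = (\<Sum>(x, p)\<in>{..<K} \<times> multi_idx K n. g (p(n := x)))"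
    unfolding multi_idx_def by (subst sum.reindex) (auto intro!: inj_combinator sum.cong)
  also have "\<dots> = (\<Sum>x<K. \<Sum>p\<in>multi_idx K n. g (p(n := x)))"
    by (rule sum.cartesian_product[symmetric])
  finally show ?thesis by (simp add: sum.swap[of _ "multi_idx K n"])
qed

definition site :: "nat \<Rightarrow> nat \<Rightarrow> nat \<Rightarrow> nat \<Rightarrow> nat \<Rightarrow> complex"
  where "site K l m i j = (if i = (j + l) mod K then omega K ^ (j * m) else 0)"

lemma add_mod_inj: "l < K \<Longrightarrow> l' < K \<Longrightarrow> (j + l) mod K = (j + l') mod K \<longleftrightarrow> l = l'" for l l' j K :: nat
  by (metis cong_add_lcancel_nat cong_def mod_less)

lemma site_orth1:
  assumes K: "K > 0" and "l < K" "l' < K" "m < K" "m' < K"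
  shows "(\<Sum>i<K. \<Sum>j<K. site K l m i j * cnj (site K l' m' i j))
    = (if l = l' \<and> m = m' then of_nat K else 0)"
proof -
  have "(\<Sum>i<K. \<Sum>j<K. site K l m i j * cnj (site K l' m' i j))
      = (\<Sum>j<K. \<Sum>i<K. site K l m i j * cnj (site K l' m' i j))"
    by (rule sum.swap)
  also have "\<dots> = (\<Sum>j<K. \<Sum>i<K. if i = (j + l) mod K then
      (if l = l' then omega K ^ (m * j) * cnj (omega K ^ (m' * j)) else 0) else 0)"
    using assms by (intro sum.cong refl) (auto simp: site_def add_mod_inj mult.commute)
  also have "\<dots> = (\<Sum>j<K. if l = l' then omega K ^ (m * j) * cnj (omega K ^ (m' * j)) else 0)"
    using K by (intro sum.cong refl) simp
  also have "\<dots> = (if l = l' \<and> m = m' then of_nat K else 0)"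
    using sum_omega[OF K assms(4,5)] by (cases "l = l'") simp_all
  finally show ?thesis .
qed

lemma site_orth2:
  assumes K: "K > 0" and "i < K" "i' < K" "j < K" "j' < K"
  shows "(\<Sum>l<K. \<Sum>m<K. site K l m i j * cnj (site K l m i' j'))
    = (if i = i' \<and> j = j' then of_nat K else 0)"
proof -
  have "(\<Sum>l<K. \<Sum>m<K. site K l m i j * cnj (site K l m i' j'))
      = (\<Sum>l<K. if i = (j + l) mod K \<and> i' = (j' + l) mod K then
          (\<Sum>m<K. omega K ^ (j * m) * cnj (omega K ^ (j' * m))) else 0)"
    by (intro sum.cong refl) (auto simp: site_def)
  also have "\<dots> = (\<Sum>l<K. if i = (j + l) mod K \<and> i = i' \<and> j = j' then of_nat K else 0)"
    using sum_omega[OF K assms(4,5)] by (intro sum.cong refl) auto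
  also have "\<dots> = (\<Sum>l<K. if l = (i + (K - j)) mod K then
      (if i = i' \<and> j = j' then of_nat K else 0) else 0)"
  proof (intro sum.cong refl)
    fix l assume l: "l \<in> {..<K}"
    have e: "i = (j + (i + (K - j)) mod K) mod K" using assms by (simp add: mod_simps)
    have "i = (j + l) mod K \<longleftrightarrow> l = (i + (K - j)) mod K"
      using l K by (subst (1) e) (auto simp: add_mod_inj)
    then show "(if i = (j + l) mod K \<and> i = i' \<and> j = j' then of_nat K else (0::complex))
      = (if l = (i + (K - j)) mod K then (if i = i' \<and> j = j' then of_nat K else 0) else 0)"
      by auto
  qed
  also have "\<dots> = (if i = i' \<and> j = j' then of_nat K else 0)" using K by simp
  finally show ?thesis .
qed

lemma hw_orth1:
  assumes K: "K > 0"
    and "\<And>k. k < n \<Longrightarrow> l k < K \<and> l' k < K \<and> m k < K \<and> m' k < K"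
  shows "(\<Sum>i<K ^ n. \<Sum>j<K ^ n. hw_basis K n l m $$ (i, j) * cnj (hw_basis K n l' m' $$ (i, j)))
    = (if \<forall>k<n. l k = l' k \<and> m k = m' k then of_nat K ^ n else 0)"
  using assms(2)
proof (induction n)
  case 0
  show ?case by (simp add: hw_basis_def)
next
  case (Suc n)
  define F where "F i j = hw_basis K n l m $$ (i, j) * cnj (hw_basis K n l' m' $$ (i, j))" for i j
  define G where "G i j = site K (l n) (m n) i j * cnj (site K (l' n) (m' n) i j)" for i j
  have "(\<Sum>i<K ^ Suc n. \<Sum>j<K ^ Suc n.
        hw_basis K (Suc n) l m $$ (i, j) * cnj (hw_basis K (Suc n) l' m' $$ (i, j)))
      = (\<Sum>i<K ^ n * K. \<Sum>j<K ^ n * K. F (i div K) (j div K) * G (i mod K) (j mod K))"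
  proof (intro sum.cong)
    fix i j assume ij: "i \<in> {..<K ^ n * K}" "j \<in> {..<K ^ n * K}"
    then have ij': "i < K ^ Suc n" "j < K ^ Suc n" by (simp_all add: mult.commute)
    show "hw_basis K (Suc n) l m $$ (i, j) * cnj (hw_basis K (Suc n) l' m' $$ (i, j))
        = F (i div K) (j div K) * G (i mod K) (j mod K)"
      unfolding hw_basis_entry_Suc[OF ij'] F_def G_def site_def by simp
  qed (simp_all add: mult.commute)
  also have "\<dots> = (\<Sum>i<K ^ n * K. \<Sum>b<K ^ n. \<Sum>d<K. F (i div K) b * G (i mod K) d)"
    by (rule sum.cong[OF refl]) (rule sum_div_mod[OF K])
  also have "\<dots> = (\<Sum>a<K ^ n. \<Sum>c<K. \<Sum>b<K ^ n. \<Sum>d<K. F a b * G c d)"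
    by (rule sum_div_mod[OF K])
  also have "\<dots> = (\<Sum>a<K ^ n. \<Sum>b<K ^ n. F a b) * (\<Sum>c<K. \<Sum>d<K. G c d)"
    by (simp add: sum_product)
  also have "(\<Sum>a<K ^ n. \<Sum>b<K ^ n. F a b)
      = (if \<forall>k<n. l k = l' k \<and> m k = m' k then of_nat K ^ n else 0)"
    unfolding F_def by (rule Suc.IH) (use Suc.prems in auto)
  also have "(\<Sum>c<K. \<Sum>d<K. G c d) = (if l n = l' n \<and> m n = m' n then of_nat K else 0)"
    unfolding G_def by (rule site_orth1[OF K]) (use Suc.prems in auto)
  finally show ?case by (auto simp: less_Suc_eq mult.commute)
qed

lemma hw_orth2:
  assumes K: "K > 0" and "i < K ^ n" "j < K ^ n" "i' < K ^ n" "j' < K ^ n"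
  shows "(\<Sum>l\<in>multi_idx K n. \<Sum>m\<in>multi_idx K n.
      hw_basis K n l m $$ (i, j) * cnj (hw_basis K n l m $$ (i', j')))
    = (if i = i' \<and> j = j' then of_nat K ^ n else 0)"
  using assms(2-)
proof (induction n arbitrary: i j i' j')
  case 0
  then show ?case by (simp add: hw_basis_def multi_idx_def)
next
  case (Suc n)
  define F where "F l m = hw_basis K n l m $$ (i div K, j div K)
    * cnj (hw_basis K n l m $$ (i' div K, j' div K))" for l m
  define G where "G x y = site K x y (i mod K) (j mod K) * cnj (site K x y (i' mod K) (j' mod K))" for x y
  have s: "hw_basis K (Suc n) (l(n := x)) (m(n := y)) $$ (i, j)
      * cnj (hw_basis K (Suc n) (l(n := x)) (m(n := y)) $$ (i', j')) = F l m * G x y" for l m x y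
  proof -
    have c: "hw_basis K n (l(n := x)) (m(n := y)) = hw_basis K n l m"
      by (rule hw_basis_cong) auto
    show ?thesis
      unfolding hw_basis_entry_Suc[OF Suc.prems(1,2)] hw_basis_entry_Suc[OF Suc.prems(3,4)]
        c F_def G_def site_def by simp
  qed
  have "(\<Sum>l\<in>multi_idx K (Suc n). \<Sum>m\<in>multi_idx K (Suc n).
        hw_basis K (Suc n) l m $$ (i, j) * cnj (hw_basis K (Suc n) l m $$ (i', j')))
      = (\<Sum>l\<in>multi_idx K n. \<Sum>x<K. \<Sum>m\<in>multi_idx K n. \<Sum>y<K. F l m * G x y)"
    by (simp only: sum_PiE_Suc s)
  also have "\<dots> = (\<Sum>l\<in>multi_idx K n. \<Sum>m\<in>multi_idx K n. F l m) * (\<Sum>x<K. \<Sum>y<K. G x y)"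
    by (simp add: sum_product)
  also have "(\<Sum>l\<in>multi_idx K n. \<Sum>m\<in>multi_idx K n. F l m)
      = (if i div K = i' div K \<and> j div K = j' div K then of_nat K ^ n else 0)"
    unfolding F_def
    by (rule Suc.IH) (use Suc.prems in \<open>auto intro!: less_mult_imp_div_less simp: mult.commute\<close>)
  also have "(\<Sum>x<K. \<Sum>y<K. G x y)
      = (if i mod K = i' mod K \<and> j mod K = j' mod K then of_nat K else 0)"
    unfolding G_def by (rule site_orth2[OF K]) (use K in auto)
  also have "(if i div K = i' div K \<and> j div K = j' div K then of_nat K ^ n else 0)
      * (if i mod K = i' mod K \<and> j mod K = j' mod K then of_nat K else 0)
      = (if i = i' \<and> j = j' then of_nat K ^ Suc n else (0::complex))"
  proof -
    have "i = i' \<longleftrightarrow> i div K = i' div K \<and> i mod K = i' mod K" by (metis div_mult_mod_eq)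
    moreover have "j = j' \<longleftrightarrow> j div K = j' div K \<and> j mod K = j' mod K" by (metis div_mult_mod_eq)
    ultimately show ?thesis by auto
  qed
  finally show ?case .
qed

theorem hw_expansion_unique:
  assumes K: "K > 0" and A: "A \<in> carrier_mat (K ^ n) (K ^ n)"
  shows "\<exists>!c. hw_expansion K n A c"
proof -
  let ?I = "multi_idx K n \<times> multi_idx K n" and ?J = "{..<K ^ n} \<times> {..<K ^ n}"
  have idx: "p k < K" if "p \<in> multi_idx K n" "k < n" for p k
    using that by (auto simp: multi_idx_def PiE_def Pi_def)
  have "\<exists>!c. (\<forall>lm. lm \<notin> ?I \<longrightarrow> c lm = 0) \<and>
      (\<forall>ij\<in>?J. A $$ ij = (\<Sum>lm\<in>?I. c lm * hw_basis K n (fst lm) (snd lm) $$ ij))"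
  proof (rule orthogonal_expansion[where q = "of_nat K ^ n"])
    fix a b assume ab: "a \<in> ?I" "b \<in> ?I"
    obtain l m l' m' where [simp]: "a = (l, m)" "b = (l', m')" by (cases a, cases b)
    have "(\<forall>k<n. l k = l' k \<and> m k = m' k) \<longleftrightarrow> a = b"
    proof -
      have "(\<forall>k<n. l k = l' k) \<longleftrightarrow> l = l'" "(\<forall>k<n. m k = m' k) \<longleftrightarrow> m = m'"
        using ab PiE_eq_iff_lt[of l n "{..<K}" l'] PiE_eq_iff_lt[of m n "{..<K}" m']
        by (simp_all add: multi_idx_def)
      then show ?thesis by (simp only: \<open>a = (l, m)\<close> \<open>b = (l', m')\<close> prod.inject) blast
    qed
    then show "(\<Sum>z\<in>?J. hw_basis K n (fst a) (snd a) $$ z * cnj (hw_basis K n (fst b) (snd b) $$ z))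
        = (if a = b then of_nat K ^ n else 0)"
      using hw_orth1[OF K, of n l l' m m'] ab idx
      by (simp add: sum.cartesian_product case_prod_beta)
  next
    fix z w assume zw: "z \<in> ?J" "w \<in> ?J"
    obtain i j i' j' where [simp]: "z = (i, j)" "w = (i', j')" by (cases z, cases w)
    show "(\<Sum>a\<in>?I. hw_basis K n (fst a) (snd a) $$ z * cnj (hw_basis K n (fst a) (snd a) $$ w))
        = (if z = w then of_nat K ^ n else 0)"
      using hw_orth2[OF K, of i n j i' j'] zw
      by (simp add: sum.cartesian_product case_prod_beta)
  qed (use K in auto)
  moreover have "(A = mat (K ^ n) (K ^ n) (\<lambda>ij. \<Sum>(l, m)\<in>?I. c (l, m) * hw_basis K n l m $$ ij))
      \<longleftrightarrow> (\<forall>ij\<in>?J. A $$ ij = (\<Sum>lm\<in>?I. c lm * hw_basis K n (fst lm) (snd lm) $$ ij))" for c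
    using A by (auto simp: mat_eq_iff case_prod_beta)
  ultimately show ?thesis unfolding hw_expansion_def by simp
qed

end

theory Submission
  imports Defs
begin

text \<open>
  The proof reduces the inequality for a matrix \<open>A\<close> to the cyclic inequality by attaching to \<open>A\<close> a
  function \<open>f\<close> on \<open>Omega_pow K (n * (K + 1))\<close> that has the same coefficients up to a bounded factor and
  is bounded by the operator norm of \<open>A\<close>.

  For prime \<open>K\<close> the plane \<open>\<int>\<^sub>K\<^sup>2\<close> of exponents \<open>(l, m)\<close> is covered by the \<open>K + 1\<close> lines through the
  origin, and two lines meet in the origin only. Up to phases, the matrices \<open>X\<^sup>l Z\<^sup>m\<close> on one line are
  the powers of one generator (\<open>X Z\<^sup>k\<close> on the line of slope \<open>k < K\<close>, and \<open>Z\<close> on the vertical line, which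
  gets the number \<open>K\<close>). In the state of an eigenvector of the generator of a line, the matrix
  \<open>X\<^sup>l Z\<^sup>m\<close> has an expectation that is a phase times a power of the eigenvalue if \<open>(l, m)\<close> is on the
  line, and zero otherwise (\<open>eigvec_form\<close>, \<open>eigvec_form_clock\<close>). Choose an eigenvector for each line,
  labelled by \<open>w k \<in> \<Omega>\<^sub>K\<close>, and average the expectations over the lines: the
  result is a single monomial in the \<open>K + 1\<close> variables \<open>w k\<close>, with a coefficient of modulus \<open>1 / (K + 1)\<close>
  (and \<open>1\<close> at the origin); this is \<open>averaged_eigvec_form\<close>.

  Taking tensor products over the \<open>n\<close> sites, \<open>f z\<close> is the average over all choices of one line
  per site of the expectation of \<open>A\<close> in the product of the chosen eigenvectors. An average of
  expectations in unit vectors is at most the operator norm (\<open>norm_cyclic_symbol_le\<close>).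
  By linearity, \<open>f\<close> has one monomial for each pair of multi-indices \<open>(l, m)\<close>
  (\<open>cyclic_symbol_eq\<close>), different pairs give different monomials because a nonzero point
  of the plane is determined by its line and one coordinate (\<open>line_index_inj\<close>), and the degree of a
  monomial is at most that of the corresponding matrix (\<open>sum_line_index_le\<close>). If \<open>A\<close> has degree at most \<open>d\<close>,
  then at most \<open>d\<close> sites carry a nontrivial matrix in any term of \<open>A\<close>, so each coefficient
  shrinks by at most the factor \<open>(K + 1)\<^sup>d\<close> on passing to \<open>f\<close> (\<open>BH_norm_hw_coeff_le\<close>). The cyclic
  inequality for \<open>f\<close> then gives the claim.
\<close>

section \<open>Coefficients and norms\<close>

lemma hw_expansion_coeff:
  assumes "K > 0" "A \<in> carrier_mat (K ^ n) (K ^ n)"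
  shows "hw_expansion K n A (hw_coeff K n A)"
  unfolding hw_coeff_def by (rule theI'[OF hw_expansion_unique[OF assms]])

lemma cyclic_coeff_eqI:
  assumes "K > 0" "cyclic_expansion K N f c"
  shows "cyclic_coeff K N f = c"
  unfolding cyclic_coeff_def using cyclic_expansion_unique[OF assms(1), of N f] assms(2)
  by (auto intro!: the_equality)

lemma BH_norm_nonneg: "0 \<le> BH_norm d I a"
  by (simp add: BH_norm_def)

text \<open>The comparison by which an inequality for the coefficients of \<open>f\<close> yields one for \<open>A\<close>: the norm
  is homogeneous, and passing from the image of \<open>h\<close> to all of \<open>J\<close> only adds nonnegative terms.\<close>

lemma BH_norm_reindex_le:
  assumes d: "d \<ge> 1" and fin: "finite J" and h: "inj_on h I" "h ` I \<subseteq> J" and M: "M \<ge> 0"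
    and le: "\<And>i. i \<in> I \<Longrightarrow> cmod (a i) \<le> M * cmod (c (h i))"
  shows "BH_norm d I a \<le> M * BH_norm d J c"
proof -
  define p where "p = 2 * real d / (real d + 1)"
  define s where "s = (real d + 1) / (2 * real d)"
  have ps: "p > 0" "s > 0" "p * s = 1" using d by (auto simp: p_def s_def)
  have "(\<Sum>i\<in>I. cmod (a i) powr p) \<le> (\<Sum>i\<in>I. M powr p * cmod (c (h i)) powr p)"
  proof (rule sum_mono)
    fix i assume "i \<in> I"
    then have "cmod (a i) powr p \<le> (M * cmod (c (h i))) powr p"
      using ps le by (intro powr_mono2) auto
    then show "cmod (a i) powr p \<le> M powr p * cmod (c (h i)) powr p"
      using M by (simp add: powr_mult)
  qed
  also have "\<dots> = M powr p * (\<Sum>j\<in>h ` I. cmod (c j) powr p)"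
    using h(1) by (simp add: sum_distrib_left sum.reindex)
  also have "\<dots> \<le> M powr p * (\<Sum>j\<in>J. cmod (c j) powr p)"
    by (intro mult_left_mono sum_mono2 fin h(2)) auto
  finally have "(\<Sum>i\<in>I. cmod (a i) powr p) powr s
      \<le> (M powr p * (\<Sum>j\<in>J. cmod (c j) powr p)) powr s"
    using ps by (intro powr_mono2) (auto intro: sum_nonneg)
  also have "\<dots> = M * (\<Sum>j\<in>J. cmod (c j) powr p) powr s"
    using ps M by (simp add: powr_mult powr_powr sum_nonneg)
  finally show ?thesis by (simp add: BH_norm_def p_def s_def)
qed

text \<open>Any bound that is uniform in \<open>v\<close> serves here: it shows that the supremum in \<open>op_norm\<close> is taken
  over a bounded set.\<close>

lemma vec_l2_mult_le_sum_entries: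
  assumes "v \<in> carrier_vec (dim_col A)" "vec_l2 v \<le> 1"
  shows "vec_l2 (A *\<^sub>v v) \<le> (\<Sum>i<dim_row A. \<Sum>j<dim_col A. cmod (A $$ (i, j)))"
proof -
  have v1: "cmod (v $ j) \<le> 1" if "j < dim_col A" for j
  proof -
    have "cmod (v $ j) \<le> vec_l2 v"
      unfolding vec_l2_def using that assms(1) by (intro member_le_L2_set) auto
    then show ?thesis using assms(2) by simp
  qed
  have "vec_l2 (A *\<^sub>v v) \<le> (\<Sum>i<dim_row A. cmod ((A *\<^sub>v v) $ i))"
    unfolding vec_l2_def dim_mult_mat_vec by (rule L2_set_le_sum) simp
  also have "\<dots> \<le> (\<Sum>i<dim_row A. \<Sum>j<dim_col A. cmod (A $$ (i, j)))"
  proof (rule sum_mono)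
    fix i assume "i \<in> {..<dim_row A}"
    then have "(A *\<^sub>v v) $ i = (\<Sum>j<dim_col A. A $$ (i, j) * v $ j)"
      using assms(1) by (auto simp: scalar_prod_def lessThan_atLeast0)
    then have "cmod ((A *\<^sub>v v) $ i) \<le> (\<Sum>j<dim_col A. cmod (A $$ (i, j)) * cmod (v $ j))"
      by (simp add: sum_norm_le norm_mult)
    also have "\<dots> \<le> (\<Sum>j<dim_col A. cmod (A $$ (i, j)) * 1)"
      using v1 by (intro sum_mono mult_left_mono) auto
    finally show "cmod ((A *\<^sub>v v) $ i) \<le> (\<Sum>j<dim_col A. cmod (A $$ (i, j)))" by simp
  qed
  finally show ?thesis .
qed

lemma vec_l2_mult_le_op_norm:
  assumes "v \<in> carrier_vec (dim_col A)" "vec_l2 v \<le> 1"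
  shows "vec_l2 (A *\<^sub>v v) \<le> op_norm A"
  unfolding op_norm_def
  by (rule cSUP_upper)
    (use assms vec_l2_mult_le_sum_entries in \<open>auto intro!: bdd_aboveI2\<close>)

lemma norm_quadratic_form_le_op_norm:
  assumes A: "A \<in> carrier_mat D D" and u: "(\<Sum>i<D. (cmod (u i))\<^sup>2) = 1"
  shows "cmod (\<Sum>i<D. \<Sum>j<D. cnj (u i) * A $$ (i, j) * u j) \<le> op_norm A"
proof -
  define v where "v = vec D u"
  have v: "v \<in> carrier_vec (dim_col A)" using A by (simp add: v_def)
  have v1: "L2_set (\<lambda>i. cmod (u i)) {..<D} = 1" by (simp add: L2_set_def u)
  have "vec_l2 v = L2_set (\<lambda>i. cmod (u i)) {..<D}"
    unfolding vec_l2_def v_def by (auto intro: L2_set_cong)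
  then have l2: "vec_l2 v \<le> 1" using v1 by simp
  have Av: "(A *\<^sub>v v) $ i = (\<Sum>j<D. A $$ (i, j) * u j)" if "i < D" for i
    using that A by (auto simp: scalar_prod_def lessThan_atLeast0 v_def)
  have "cmod (\<Sum>i<D. \<Sum>j<D. cnj (u i) * A $$ (i, j) * u j)
      = cmod (\<Sum>i<D. cnj (u i) * (A *\<^sub>v v) $ i)"
    by (simp add: Av sum_distrib_left mult.assoc del: index_mult_mat_vec)
  also have "\<dots> \<le> (\<Sum>i<D. \<bar>cmod (u i)\<bar> * \<bar>cmod ((A *\<^sub>v v) $ i)\<bar>)"
    by (rule order_trans[OF norm_sum]) (simp add: norm_mult)
  also have "\<dots> \<le> L2_set (\<lambda>i. cmod (u i)) {..<D} * L2_set (\<lambda>i. cmod ((A *\<^sub>v v) $ i)) {..<D}"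
    by (rule L2_set_mult_ineq)
  also have "\<dots> = vec_l2 (A *\<^sub>v v)" using A v1 by (simp add: vec_l2_def)
  also have "\<dots> \<le> op_norm A" by (rule vec_l2_mult_le_op_norm[OF v l2])
  finally show ?thesis .
qed

section \<open>Eigenvectors of the generators\<close>

definition triangular :: "nat \<Rightarrow> nat"
  where "triangular j = \<Sum>{..<j}"

lemma triangular_add: "triangular (j + l) = triangular j + j * l + triangular l"
  by (induction l) (simp_all add: triangular_def)

text \<open>A \<open>K\<close>-th root of \<open>(X Z\<^sup>k)\<^sup>K\<close>, which is the scalar \<open>\<omega>\<close> to the power \<open>k * triangular K\<close>. So
  the eigenvalues of \<open>X Z\<^sup>k\<close> are the numbers \<open>root_phase K k * w\<close> with \<open>w \<in> \<Omega>\<^sub>K\<close>. (For \<open>K = 2\<close> and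
  \<open>k = 1\<close> they are \<open>\<plusminus>\<i>\<close>, which are not in \<open>\<Omega>\<^sub>2\<close>.)\<close>

definition root_phase :: "nat \<Rightarrow> nat \<Rightarrow> complex"
  where "root_phase K k = cis (2 * pi * real (k * triangular K) / real K / real K)"

lemma root_phase_pow: "K > 0 \<Longrightarrow> root_phase K k ^ K = omega K ^ (k * triangular K)"
  unfolding root_phase_def omega_def DeMoivre by (rule arg_cong[of _ _ cis]) simp

lemma norm_root_phase [simp]: "cmod (root_phase K k) = 1"
  by (simp add: root_phase_def)

lemma norm_omega [simp]: "cmod (omega K) = 1"
  by (simp add: omega_def)

lemma Omega_norm: "w \<in> Omega K \<Longrightarrow> cmod w = 1"
  by (auto simp: Omega_def norm_power)

lemma Omega_pow_K: "w \<in> Omega K \<Longrightarrow> K > 0 \<Longrightarrow> w ^ K = 1"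
  by (auto simp: Omega_def omega_pow_K power_mult[symmetric] mult.commute[of _ K])
    (simp add: power_mult omega_pow_K)

lemma mult_cnj_unimodular: "cmod x = 1 \<Longrightarrow> x * cnj x = 1"
  by (simp add: complex_norm_square[symmetric])

text \<open>For \<open>\<lambda> = root_phase K k * w\<close> the eigenvector equation \<open>X Z\<^sup>k v = \<lambda> v\<close> is the recursion
  \<open>\<omega>\<^bsup>k j\<^esup> v\<^sub>j = \<lambda> v\<^sub>j\<^sub>+\<^sub>1\<close>, and \<open>chirp K k w\<close> is its solution with \<open>v\<^sub>0 = 1\<close>. The choice of
  \<open>root_phase\<close> makes it periodic with period \<open>K\<close>.\<close>

definition chirp :: "nat \<Rightarrow> nat \<Rightarrow> complex \<Rightarrow> nat \<Rightarrow> complex"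
  where "chirp K k w j = cnj (root_phase K k * w) ^ j * omega K ^ (k * triangular j)"

text \<open>The unit eigenvector with label \<open>w\<close> of the generator of the line \<open>k\<close>; \<open>k = K\<close> stands for the
  vertical line, whose generator \<open>Z\<close> has the canonical basis as eigenvectors.\<close>

definition eigvec :: "nat \<Rightarrow> nat \<Rightarrow> complex \<Rightarrow> nat \<Rightarrow> complex"
  where "eigvec K k w j = (if k = K then (if w = omega K ^ j then 1 else 0)
    else chirp K k w j / of_real (sqrt (real K)))"

lemma chirp_add:
  "chirp K k w (j + l) = chirp K k w j * chirp K k w l * omega K ^ (k * l * j)"
  by (simp add: chirp_def triangular_add power_add algebra_simps)

lemma chirp_K:
  assumes "K > 0" "w \<in> Omega K"
  shows "chirp K k w K = 1"
proof -
  have "chirp K k w K = cnj (root_phase K k ^ K * w ^ K) * omega K ^ (k * triangular K)"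
    by (simp add: chirp_def power_mult_distrib)
  also have "\<dots> = cnj (omega K ^ (k * triangular K)) * omega K ^ (k * triangular K)"
    by (simp only: root_phase_pow[OF assms(1)] Omega_pow_K[OF assms(2,1)] mult_1_right)
  also have "\<dots> = 1"
    using mult_cnj_unimodular[of "omega K ^ (k * triangular K)"]
    by (simp add: norm_power mult.commute)
  finally show ?thesis .
qed

lemma omega_pow_mult_K: "K > 0 \<Longrightarrow> omega K ^ (K * a) = 1"
  by (simp add: power_mult omega_pow_K)

lemma chirp_mod:
  assumes "K > 0" "w \<in> Omega K"
  shows "chirp K k w (j mod K) = chirp K k w j"
proof -
  have step: "chirp K k w (a + K) = chirp K k w a" for a
    using omega_pow_mult_K[OF assms(1), of "k * a"]
    by (simp add: chirp_add chirp_K[OF assms] mult_ac)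
  have "chirp K k w (a + K * b) = chirp K k w a" for a b
  proof (induction b)
    case (Suc b)
    then show ?case using step[of "a + K * b"] by (simp add: algebra_simps)
  qed simp
  from this[of "j mod K" "j div K"] show ?thesis by simp
qed

lemma norm_chirp: "w \<in> Omega K \<Longrightarrow> cmod (chirp K k w j) = 1"
  by (simp add: chirp_def norm_mult norm_power Omega_norm)

lemma omega_pow_mod:
  assumes "K > 0"
  shows "omega K ^ (a mod K * j) = omega K ^ (a * j)"
proof -
  have "a * j = (K * (a div K) + a mod K) * j" by simp
  also have "\<dots> = K * (a div K * j) + a mod K * j"
    by (simp only: distrib_right mult.assoc)
  finally show ?thesis by (simp only: power_add omega_pow_mult_K[OF assms] mult_1_left)
qed

text \<open>The phase left over when \<open>X\<^sup>l Z\<^sup>m\<close> on the line \<open>k\<close> is written as the \<open>l\<close>-th power of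
  \<open>X Z\<^sup>k\<close> and \<open>w\<^sup>l\<close> is split off from the eigenvalue.\<close>

definition line_phase :: "nat \<Rightarrow> nat \<Rightarrow> nat \<Rightarrow> complex"
  where "line_phase K k l = (if k = K then 1
    else root_phase K k ^ l * cnj (omega K ^ (k * triangular l)))"

lemma norm_line_phase [simp]: "cmod (line_phase K k l) = 1"
  by (simp add: line_phase_def norm_mult norm_power)

lemma site_form:
  assumes K: "K > 0"
  shows "(\<Sum>i<K. \<Sum>j<K. cnj (u i) * site K l m i j * u j)
    = (\<Sum>j<K. cnj (u ((j + l) mod K)) * omega K ^ (j * m) * u j)"
proof -
  have "(\<Sum>i<K. \<Sum>j<K. cnj (u i) * site K l m i j * u j)
      = (\<Sum>j<K. \<Sum>i<K. if i = (j + l) mod K then cnj (u i) * omega K ^ (j * m) * u j else 0)"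
    by (subst sum.swap) (intro sum.cong refl, simp add: site_def)
  also have "\<dots> = (\<Sum>j<K. cnj (u ((j + l) mod K)) * omega K ^ (j * m) * u j)"
    using K by (intro sum.cong refl) simp
  finally show ?thesis .
qed

text \<open>By \<open>chirp_add\<close>, the summand with index \<open>j\<close> is a constant times \<open>\<omega>\<close> to the power \<open>(m - k l) j\<close>,
  so the orthogonality of characters selects the points on the line.\<close>

lemma eigvec_form:
  assumes K: "K > 0" and w: "w \<in> Omega K" and lm: "l < K" "m < K" and k: "k < K"
  shows "(\<Sum>i<K. \<Sum>j<K. cnj (eigvec K k w i) * site K l m i j * eigvec K k w j)
    = (if m = k * l mod K then line_phase K k l * w ^ l else 0)"
proof -
  have t: "cnj (eigvec K k w ((j + l) mod K)) * omega K ^ (j * m) * eigvec K k w j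
      = cnj (chirp K k w l) / of_nat K
        * (omega K ^ (m * j) * cnj (omega K ^ (k * l mod K * j)))" for j
  proof -
    have sq: "of_real (sqrt (real K)) * of_real (sqrt (real K)) = (of_nat K :: complex)"
      by (simp flip: of_real_mult)
    have "cnj (eigvec K k w ((j + l) mod K)) * omega K ^ (j * m) * eigvec K k w j
      = cnj (chirp K k w (j + l)) * omega K ^ (j * m) * chirp K k w j
         / (of_real (sqrt (real K)) * of_real (sqrt (real K)))"
      using k by (simp add: eigvec_def chirp_mod[OF K w])
    also have "\<dots> = (chirp K k w j * cnj (chirp K k w j)) * cnj (chirp K k w l)
        * cnj (omega K ^ (k * l * j)) * omega K ^ (m * j) / of_nat K"
      unfolding sq chirp_add by (simp add: mult_ac)
    finally show ?thesis
      unfolding mult_cnj_unimodular[OF norm_chirp[OF w]] omega_pow_mod[OF K]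
      by (simp add: mult_ac)
  qed
  have "(\<Sum>i<K. \<Sum>j<K. cnj (eigvec K k w i) * site K l m i j * eigvec K k w j)
      = cnj (chirp K k w l) / of_nat K
        * (\<Sum>j<K. omega K ^ (m * j) * cnj (omega K ^ (k * l mod K * j)))"
    unfolding site_form[OF K] t by (simp only: sum_distrib_left)
  also have "\<dots> = (if m = k * l mod K then cnj (chirp K k w l) else 0)"
    using sum_omega[OF K lm(2), of "k * l mod K"] K by simp
  also have "cnj (chirp K k w l) = line_phase K k l * w ^ l"
    using k by (simp add: chirp_def line_phase_def power_mult_distrib)
  finally show ?thesis .
qed

lemma eigvec_form_clock:
  assumes K: "K > 0" and w: "w \<in> Omega K" and lm: "l < K" "m < K"
  shows "(\<Sum>i<K. \<Sum>j<K. cnj (eigvec K K w i) * site K l m i j * eigvec K K w j)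
    = (if l = 0 then w ^ m else 0)"
proof -
  obtain a where a: "a < K" "w = omega K ^ a" using w by (auto simp: Omega_def)
  have e: "eigvec K K w j = (if j = a then 1 else 0)" if "j < K" for j
    using that a inj_on_eq_iff[OF inj_omega_pow[OF K], of a j] by (auto simp: eigvec_def)
  have "(\<Sum>i<K. \<Sum>j<K. cnj (eigvec K K w i) * site K l m i j * eigvec K K w j)
      = (\<Sum>j<K. if j = a then (if (j + l) mod K = a then omega K ^ (j * m) else 0) else 0)"
    unfolding site_form[OF K] using K by (intro sum.cong refl) (simp add: e)
  also have "\<dots> = (if (a + l) mod K = a then omega K ^ (a * m) else 0)"
    using a by simp
  also have "(a + l) mod K = a \<longleftrightarrow> l = 0"
    using add_mod_inj[of l K 0 a] a lm K by simp
  finally show ?thesis by (simp add: a power_mult)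
qed

text \<open>The identity matrix is \<open>X\<^sup>0 Z\<^sup>0\<close>, which is on every line, so the norm is a special case of
  the two expectations above.\<close>

lemma eigvec_normalized:
  assumes K: "K > 0" and w: "w \<in> Omega K" and k: "k \<le> K"
  shows "(\<Sum>j<K. (cmod (eigvec K k w j))\<^sup>2) = 1"
proof -
  have "(\<Sum>i<K. \<Sum>j<K. cnj (eigvec K k w i) * site K 0 0 i j * eigvec K k w j) = 1"
    using eigvec_form[OF K w, of 0 0 k] eigvec_form_clock[OF K w, of 0 0] K k
    by (cases "k = K") (auto simp: line_phase_def triangular_def)
  then have "(\<Sum>j<K. cnj (eigvec K k w j) * eigvec K k w j) = 1"
    unfolding site_form[OF K] by simp
  moreover have "cnj (eigvec K k w j) * eigvec K k w j = of_real ((cmod (eigvec K k w j))\<^sup>2)" for j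
    by (subst complex_norm_square) simp
  ultimately have "complex_of_real (\<Sum>j<K. (cmod (eigvec K k w j))\<^sup>2) = 1"
    by (simp only: of_real_sum)
  then show ?thesis by (simp only: of_real_eq_1_iff)
qed

section \<open>Lines through the origin\<close>

text \<open>The number of the line through \<open>(l, m)\<close>. The origin is on all lines; the value \<open>K\<close> assigned to it
  is arbitrary, and harmless because its \<open>line_coord\<close> is zero.\<close>

definition slope :: "nat \<Rightarrow> nat \<Rightarrow> nat \<Rightarrow> nat"
  where "slope K l m = (if l = 0 then K else (THE k. k < K \<and> m = k * l mod K))"

lemma slope_unique:
  fixes K l m :: nat
  assumes K: "prime K" and "0 < l" "l < K" "m < K"
  shows "\<exists>!k. k < K \<and> m = k * l mod K"
proof -
  have "\<not> K dvd l" using assms(2,3) by (rule nat_dvd_not_less)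
  then have cop: "coprime l K" by (metis K coprime_commute prime_imp_coprime)
  have K0: "K > 0" using assms by simp
  obtain b where b: "[l * b = 1] (mod K)" using cong_solve_coprime_nat[OF cop] by auto
  have "[m * b * l = m * 1] (mod K)"
    using cong_mult[OF cong_refl b, of m] by (simp add: mult_ac)
  then have "m = (m * b mod K) * l mod K"
    using assms by (simp add: cong_def mod_mult_left_eq)
  moreover have "k = k'" if "k < K" "k' < K" "k * l mod K = k' * l mod K" for k k'
  proof -
    have "[k * l = k' * l] (mod K)" using that by (simp add: cong_def)
    then have "[k = k'] (mod K)" using cop by (simp add: cong_mult_rcancel_nat)
    then show ?thesis using that by (simp add: cong_def)
  qed
  moreover have "m * b mod K < K" using K0 by simp
  ultimately show ?thesis by metis
qed

lemma slope_pos: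
  assumes "prime K" "0 < l" "l < K" "m < K"
  shows "slope K l m < K" "m = slope K l m * l mod K"
    "k < K \<Longrightarrow> m = k * l mod K \<Longrightarrow> k = slope K l m"
proof -
  have e: "slope K l m = (THE k. k < K \<and> m = k * l mod K)"
    using assms(2) by (simp add: slope_def)
  have p: "slope K l m < K \<and> m = slope K l m * l mod K"
    unfolding e by (rule theI'[OF slope_unique[OF assms]])
  then show "slope K l m < K" "m = slope K l m * l mod K" by blast+
  show "k < K \<Longrightarrow> m = k * l mod K \<Longrightarrow> k = slope K l m"
    using p slope_unique[OF assms] by blast
qed

lemma slope_zero [simp]: "slope K 0 m = K"
  by (simp add: slope_def)

text \<open>The exponent of the eigenvalue label in the expectation of \<open>X\<^sup>l Z\<^sup>m\<close>. It is at most \<open>l + m\<close>,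
  and it vanishes only at the origin.\<close>

definition line_coord :: "nat \<Rightarrow> nat \<Rightarrow> nat"
  where "line_coord l m = (if l = 0 then m else l)"

definition line_exponent :: "nat \<Rightarrow> nat \<Rightarrow> nat \<Rightarrow> nat \<Rightarrow> nat"
  where "line_exponent K l m k = (if k = slope K l m then line_coord l m else 0)"

definition line_weight :: "nat \<Rightarrow> nat \<Rightarrow> nat \<Rightarrow> complex"
  where "line_weight K l m =
    (if l = 0 \<and> m = 0 then 1 else line_phase K (slope K l m) l / of_nat (K + 1))"

lemma slope_le: "prime K \<Longrightarrow> l < K \<Longrightarrow> m < K \<Longrightarrow> slope K l m \<le> K"
  using slope_pos(1)[of K l m] by (cases "l = 0") auto

text \<open>Away from the origin, only the line of slope \<open>slope K l m\<close> contributes to the sum. At the origin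
  all \<open>K + 1\<close> lines contribute \<open>1\<close>.\<close>

lemma averaged_eigvec_form:
  assumes K: "prime K" and lm: "l < K" "m < K" and w: "\<And>k. k \<le> K \<Longrightarrow> w k \<in> Omega K"
  shows "(\<Sum>k<K + 1. \<Sum>i<K. \<Sum>j<K. cnj (eigvec K k (w k) i) * site K l m i j * eigvec K k (w k) j)
      / of_nat (K + 1)
    = line_weight K l m * (\<Prod>k<K + 1. w k ^ line_exponent K l m k)"
proof -
  have K0: "K > 0" using K by (simp add: prime_gt_0_nat)
  define q where "q k = (\<Sum>i<K. \<Sum>j<K. cnj (eigvec K k (w k) i) * site K l m i j * eigvec K k (w k) j)" for k
  have s: "slope K l m < K + 1" using slope_le[OF K lm] by simp
  have "(\<Prod>k<K + 1. w k ^ line_exponent K l m k)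
      = (\<Prod>k<K + 1. if k = slope K l m then w k ^ line_coord l m else 1)"
    by (rule prod.cong) (auto simp: line_exponent_def)
  also have "\<dots> = w (slope K l m) ^ line_coord l m" using s by simp
  finally have P: "(\<Prod>k<K + 1. w k ^ line_exponent K l m k) = w (slope K l m) ^ line_coord l m" .
  have qk: "q k = (if m = k * l mod K then line_phase K k l * w k ^ l else 0)" if "k < K" for k
    unfolding q_def using eigvec_form[OF K0 _ lm that] w[of k] that by simp
  have qK: "q K = (if l = 0 then w K ^ m else 0)"
    unfolding q_def using eigvec_form_clock[OF K0 w lm] by simp
  show ?thesis
  proof (cases "l = 0 \<and> m = 0")
    case True
    have "(\<Sum>k<K + 1. q k) = (\<Sum>k<K + 1. 1)"
    proof (rule sum.cong[OF refl])
      fix k assume "k \<in> {..<K + 1}"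
      then consider "k < K" | "k = K" by fastforce
      then show "q k = 1"
        using True by cases (auto simp: qk qK line_phase_def triangular_def)
    qed
    then show ?thesis
      unfolding P q_def[symmetric] using True
      by (simp add: line_weight_def line_coord_def del: of_nat_Suc of_nat_add)
  next
    case False
    have "(\<Sum>k<K + 1. q k) = (\<Sum>k<K + 1. if k = slope K l m
        then line_phase K (slope K l m) l * w (slope K l m) ^ line_coord l m else 0)"
    proof (rule sum.cong[OF refl])
      fix k assume "k \<in> {..<K + 1}"
      then have k: "k < K \<or> k = K" by auto
      show "q k = (if k = slope K l m
        then line_phase K (slope K l m) l * w (slope K l m) ^ line_coord l m else 0)"
      proof (cases "l = 0")
        case True
        then show ?thesis using k False by (auto simp: qk qK line_phase_def line_coord_def)
      next
        case l0: False
        show ?thesis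
        proof (cases "k = K")
          case True
          then show ?thesis using l0 slope_pos(1)[OF K _ lm] by (simp add: qK)
        next
          case False
          then have "k < K" using k by simp
          moreover from this have "m = k * l mod K \<longleftrightarrow> k = slope K l m"
            using l0 slope_pos(2,3)[OF K _ lm] by blast
          ultimately show ?thesis using l0 by (simp only: qk line_coord_def if_False) simp
        qed
      qed
    qed
    also have "\<dots> = line_phase K (slope K l m) l * w (slope K l m) ^ line_coord l m"
      using s by simp
    finally show ?thesis
      unfolding P q_def[symmetric] line_weight_def if_not_P[OF False]
      by (simp only: times_divide_eq_left)
  qed
qed

text \<open>Writing the exponent as \<open>l + m\<close> makes the bounds at the sites multiply to a power whose exponent
  is the degree.\<close>

lemma norm_line_weight_ge: "(1 / real (K + 1)) ^ (l + m) \<le> cmod (line_weight K l m)"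
proof (cases "l = 0 \<and> m = 0")
  case False
  then have "(1 / real (K + 1)) ^ (l + m) \<le> (1 / real (K + 1)) ^ 1"
    by (intro power_decreasing) auto
  then show ?thesis using False
    by (simp add: line_weight_def norm_divide del: of_nat_Suc of_nat_add)
qed (simp add: line_weight_def)

text \<open>For the origin no variable occurs. Otherwise the variable that occurs gives the line and its exponent gives one coordinate; on a line that is
  not vertical, the coordinate \<open>l\<close> determines \<open>m\<close>.\<close>

lemma line_exponent_inj:
  assumes K: "prime K" and lm: "l < K" "m < K" "l' < K" "m' < K"
    and eq: "\<And>k. k < K + 1 \<Longrightarrow> line_exponent K l m k = line_exponent K l' m' k"
  shows "l = l' \<and> m = m'"
proof -
  have s: "slope K l m < K + 1" "slope K l' m' < K + 1"
    using slope_le[OF K] lm by (simp_all add: le_imp_less_Suc)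
  have e: "line_coord l m = (if slope K l m = slope K l' m' then line_coord l' m' else 0)"
    "line_coord l' m' = (if slope K l' m' = slope K l m then line_coord l m else 0)"
    using eq[OF s(1)] eq[OF s(2)] by (simp_all add: line_exponent_def)
  have p: "l \<noteq> 0 \<Longrightarrow> slope K l m < K \<and> m = slope K l m * l mod K"
    "l' \<noteq> 0 \<Longrightarrow> slope K l' m' < K \<and> m' = slope K l' m' * l' mod K"
    using slope_pos(1,2)[OF K] lm by simp_all
  show ?thesis
  proof (cases "slope K l m = slope K l' m'")
    case True
    then have "l = 0 \<longleftrightarrow> l' = 0" using p by (metis less_irrefl slope_zero)
    moreover have "line_coord l m = line_coord l' m'" using e(1) True by simp
    ultimately show ?thesis using p True unfolding line_coord_def by metis
  next
    case False
    then show ?thesis using e by (auto simp: line_coord_def split: if_splits)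
  qed
qed

section \<open>Product vectors\<close>

text \<open>The indices split by \<open>div\<close> and \<open>mod\<close> as in \<open>kronecker\<close>, so that the last tensor factor is the
  least significant digit.\<close>

primrec product_vec :: "nat \<Rightarrow> (nat \<Rightarrow> nat \<Rightarrow> complex) \<Rightarrow> nat \<Rightarrow> nat \<Rightarrow> complex"
  where
    "product_vec K u 0 i = 1"
  | "product_vec K u (Suc n) i = product_vec K u n (i div K) * u n (i mod K)"

lemma product_vec_norm:
  assumes K: "K > 0"
  shows "(\<Sum>i<K ^ n. (cmod (product_vec K u n i))\<^sup>2) = (\<Prod>k<n. \<Sum>i<K. (cmod (u k i))\<^sup>2)"
proof (induction n)
  case (Suc n)
  have "(\<Sum>i<K ^ Suc n. complex_of_real ((cmod (product_vec K u (Suc n) i))\<^sup>2))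
      = (\<Sum>i<K ^ n * K. complex_of_real ((cmod (product_vec K u n (i div K)))\<^sup>2)
          * complex_of_real ((cmod (u n (i mod K)))\<^sup>2))"
    by (simp add: norm_mult power_mult_distrib mult.commute)
  also have "\<dots> = (\<Sum>a<K ^ n. \<Sum>b<K. complex_of_real ((cmod (product_vec K u n a))\<^sup>2)
      * complex_of_real ((cmod (u n b))\<^sup>2))"
    by (rule sum_div_mod[OF K])
  also have "\<dots> = complex_of_real ((\<Sum>a<K ^ n. (cmod (product_vec K u n a))\<^sup>2)
      * (\<Sum>b<K. (cmod (u n b))\<^sup>2))"
    by (simp add: sum_product)
  finally show ?case using Suc.IH by (simp only: of_real_eq_iff flip: of_real_sum) simp
qed simp

lemma product_vec_form:
  assumes K: "K > 0"
  shows "(\<Sum>i<K ^ n. \<Sum>j<K ^ n.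
      cnj (product_vec K u n i) * hw_basis K n l m $$ (i, j) * product_vec K u n j)
    = (\<Prod>k<n. \<Sum>i<K. \<Sum>j<K. cnj (u k i) * site K (l k) (m k) i j * u k j)"
proof (induction n)
  case 0
  show ?case by (simp add: hw_basis_def)
next
  case (Suc n)
  define F where "F i j = cnj (product_vec K u n i) * hw_basis K n l m $$ (i, j)
    * product_vec K u n j" for i j
  define G where "G i j = cnj (u n i) * site K (l n) (m n) i j * u n j" for i j
  have "(\<Sum>i<K ^ Suc n. \<Sum>j<K ^ Suc n. cnj (product_vec K u (Suc n) i)
        * hw_basis K (Suc n) l m $$ (i, j) * product_vec K u (Suc n) j)
      = (\<Sum>i<K ^ n * K. \<Sum>j<K ^ n * K. F (i div K) (j div K) * G (i mod K) (j mod K))"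
  proof (intro sum.cong)
    fix i j assume "i \<in> {..<K ^ n * K}" "j \<in> {..<K ^ n * K}"
    then have ij: "i < K ^ Suc n" "j < K ^ Suc n" by (simp_all add: mult.commute)
    show "cnj (product_vec K u (Suc n) i) * hw_basis K (Suc n) l m $$ (i, j)
        * product_vec K u (Suc n) j = F (i div K) (j div K) * G (i mod K) (j mod K)"
      unfolding hw_basis_entry_Suc[OF ij] F_def G_def site_def by simp
  qed (simp_all add: mult.commute)
  also have "\<dots> = (\<Sum>i<K ^ n * K. \<Sum>b<K ^ n. \<Sum>d<K. F (i div K) b * G (i mod K) d)"
    by (rule sum.cong[OF refl]) (rule sum_div_mod[OF K])
  also have "\<dots> = (\<Sum>a<K ^ n. \<Sum>c<K. \<Sum>b<K ^ n. \<Sum>d<K. F a b * G c d)"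
    by (rule sum_div_mod[OF K])
  also have "\<dots> = (\<Sum>a<K ^ n. \<Sum>b<K ^ n. F a b) * (\<Sum>c<K. \<Sum>d<K. G c d)"
    by (simp add: sum_product)
  finally show ?case unfolding F_def G_def Suc.IH by simp
qed

lemma hw_expansion_form:
  assumes "hw_expansion K n A c"
  shows "(\<Sum>i<K ^ n. \<Sum>j<K ^ n. cnj (v i) * A $$ (i, j) * v j)
    = (\<Sum>(l, m)\<in>multi_idx K n \<times> multi_idx K n. c (l, m) *
        (\<Sum>i<K ^ n. \<Sum>j<K ^ n. cnj (v i) * hw_basis K n l m $$ (i, j) * v j))"
proof -
  let ?I = "multi_idx K n \<times> multi_idx K n"
  have A: "A = mat (K ^ n) (K ^ n)
      (\<lambda>ij. \<Sum>(l, m)\<in>?I. c (l, m) * hw_basis K n l m $$ ij)"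
    using assms by (simp add: hw_expansion_def)
  have "(\<Sum>i<K ^ n. \<Sum>j<K ^ n. cnj (v i) * A $$ (i, j) * v j)
      = (\<Sum>i<K ^ n. \<Sum>j<K ^ n. \<Sum>lm\<in>?I.
          c lm * (cnj (v i) * hw_basis K n (fst lm) (snd lm) $$ (i, j) * v j))"
    by (subst A)
      (auto intro!: sum.cong simp: sum_distrib_left sum_distrib_right case_prod_beta mult_ac)
  also have "\<dots> = (\<Sum>i<K ^ n. \<Sum>lm\<in>?I. \<Sum>j<K ^ n.
          c lm * (cnj (v i) * hw_basis K n (fst lm) (snd lm) $$ (i, j) * v j))"
    by (intro sum.cong refl sum.swap)
  also have "\<dots> = (\<Sum>lm\<in>?I. \<Sum>i<K ^ n. \<Sum>j<K ^ n.
          c lm * (cnj (v i) * hw_basis K n (fst lm) (snd lm) $$ (i, j) * v j))"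
    by (rule sum.swap)
  finally show ?thesis by (simp add: sum_distrib_left case_prod_beta)
qed

section \<open>The cyclic polynomial of a matrix\<close>

text \<open>The function \<open>f\<close> of the introduction. The variables come in \<open>n\<close> blocks of length \<open>K + 1\<close>: the label
  of the eigenvector for the line \<open>s\<close> at the site \<open>k\<close> is \<open>z (k * (K + 1) + s)\<close>.\<close>

definition cyclic_symbol :: "nat \<Rightarrow> nat \<Rightarrow> complex mat \<Rightarrow> (nat \<Rightarrow> complex) \<Rightarrow> complex"
  where "cyclic_symbol K n A z =
    (\<Sum>s\<in>{..<n} \<rightarrow>\<^sub>E {..<K + 1}. \<Sum>i<K ^ n. \<Sum>j<K ^ n.
      cnj (product_vec K (\<lambda>k. eigvec K (s k) (z (k * (K + 1) + s k))) n i) * A $$ (i, j)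
        * product_vec K (\<lambda>k. eigvec K (s k) (z (k * (K + 1) + s k))) n j) / of_nat (K + 1) ^ n"

text \<open>The exponents of the monomial of \<open>cyclic_symbol\<close> that comes from the basis matrix with multi-indices
  \<open>lm\<close>.\<close>

definition line_index :: "nat \<Rightarrow> nat \<Rightarrow> (nat \<Rightarrow> nat) \<times> (nat \<Rightarrow> nat) \<Rightarrow> nat \<Rightarrow> nat"
  where "line_index K n lm = (\<lambda>i\<in>{..<n * (K + 1)}.
    line_exponent K (fst lm (i div (K + 1))) (snd lm (i div (K + 1))) (i mod (K + 1)))"

lemma block_index_less: "k < n \<Longrightarrow> s < Q \<Longrightarrow> k * Q + s < n * Q" for k n s Q :: nat
proof -
  assume "k < n" "s < Q"
  then have "k * Q + s < Suc k * Q" by simp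
  also have "\<dots> \<le> n * Q" using \<open>k < n\<close> by (intro mult_right_mono) auto
  finally show ?thesis .
qed

lemma multi_idx_pair_less:
  assumes "lm \<in> multi_idx K n \<times> multi_idx K n" "k < n"
  shows "fst lm k < K" "snd lm k < K"
  using assms by (auto simp: multi_idx_def mem_Times_iff PiE_def Pi_def)

lemma line_index_block:
  assumes "k < n" and s: "s < K + 1"
  shows "line_index K n lm (k * (K + 1) + s) = line_exponent K (fst lm k) (snd lm k) s"
proof -
  have "k * (K + 1) + s \<in> {..<n * (K + 1)}" using block_index_less[OF assms] by simp
  moreover have "(k * (K + 1) + s) div (K + 1) = k" "(k * (K + 1) + s) mod (K + 1) = s"
    using s by (simp_all del: mult_Suc_right add_Suc_right add: div_add1_eq mod_mult_self3)
  ultimately show ?thesis unfolding line_index_def by (simp only: restrict_apply' if_True)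
qed

lemma norm_cyclic_symbol_le:
  assumes K: "K > 0" and A: "A \<in> carrier_mat (K ^ n) (K ^ n)"
    and z: "z \<in> Omega_pow K (n * (K + 1))"
  shows "cmod (cyclic_symbol K n A z) \<le> op_norm A"
proof -
  let ?S = "{..<n} \<rightarrow>\<^sub>E {..<K + 1}"
  let ?u = "\<lambda>s k. eigvec K (s k) (z (k * (K + 1) + s k))"
  have card: "real (card ?S) = real (K + 1) ^ n"
    by (subst card_PiE) auto
  have "cmod (\<Sum>s\<in>?S. \<Sum>i<K ^ n. \<Sum>j<K ^ n.
      cnj (product_vec K (?u s) n i) * A $$ (i, j) * product_vec K (?u s) n j) \<le> (\<Sum>s\<in>?S. op_norm A)"
  proof (rule sum_norm_le)
    fix s assume s: "s \<in> ?S"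
    have "(\<Sum>i<K. (cmod (?u s k i))\<^sup>2) = 1" if k: "k < n" for k
    proof -
      have sk: "s k < K + 1" using s k by (auto simp: PiE_def Pi_def)
      have "z (k * (K + 1) + s k) \<in> Omega K"
        using z block_index_less[OF k sk] unfolding Omega_pow_def by (auto simp: PiE_def Pi_def)
      then show ?thesis using eigvec_normalized[OF K] sk by simp
    qed
    then have "(\<Sum>i<K ^ n. (cmod (product_vec K (?u s) n i))\<^sup>2) = 1"
      unfolding product_vec_norm[OF K] by (intro prod.neutral) simp
    then show "cmod (\<Sum>i<K ^ n. \<Sum>j<K ^ n.
      cnj (product_vec K (?u s) n i) * A $$ (i, j) * product_vec K (?u s) n j) \<le> op_norm A"
      by (rule norm_quadratic_form_le_op_norm[OF A])
  qed
  also have "\<dots> = real (K + 1) ^ n * op_norm A" using card by simp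
  finally show ?thesis
    unfolding cyclic_symbol_def norm_divide norm_power norm_of_nat
    by (subst pos_divide_le_eq) (simp_all add: mult.commute)
qed

lemma prod_blocks:
  fixes g :: "nat \<Rightarrow> 'a::comm_monoid_mult"
  shows "(\<Prod>i<n * Q. g i) = (\<Prod>k<n. \<Prod>s<Q. g (k * Q + s))"
proof -
  have "(\<Prod>i<n * Q. g i) = (\<Prod>k<n. \<Prod>i = k * Q..<k * Q + Q. g i)"
    by (rule prod.nat_group[symmetric])
  also have "\<dots> = (\<Prod>k<n. \<Prod>s<Q. g (k * Q + s))"
  proof (rule prod.cong[OF refl])
    fix k
    show "(\<Prod>i = k * Q..<k * Q + Q. g i) = (\<Prod>s<Q. g (k * Q + s))"
      unfolding prod.atLeastLessThan_shift_0[of g "k * Q"] by (simp add: lessThan_atLeast0)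
  qed
  finally show ?thesis .
qed

lemma sum_blocks:
  fixes g :: "nat \<Rightarrow> 'a::comm_monoid_add"
  shows "(\<Sum>i<n * Q. g i) = (\<Sum>k<n. \<Sum>s<Q. g (k * Q + s))"
proof -
  have "(\<Sum>i<n * Q. g i) = (\<Sum>k<n. \<Sum>i = k * Q..<k * Q + Q. g i)"
    by (rule sum.nat_group[symmetric])
  also have "\<dots> = (\<Sum>k<n. \<Sum>s<Q. g (k * Q + s))"
  proof (rule sum.cong[OF refl])
    fix k
    show "(\<Sum>i = k * Q..<k * Q + Q. g i) = (\<Sum>s<Q. g (k * Q + s))"
      unfolding sum.atLeastLessThan_shift_0[of g "k * Q"] by (simp add: lessThan_atLeast0)
  qed
  finally show ?thesis .
qed

text \<open>The average over all choices \<open>s\<close> of lines factors into averages over the single sites, by the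
  distributive law \<open>prod_sum_PiE\<close>.\<close>

lemma cyclic_symbol_eq:
  assumes K: "prime K" and A: "hw_expansion K n A c"
    and z: "z \<in> Omega_pow K (n * (K + 1))"
  shows "cyclic_symbol K n A z = (\<Sum>lm\<in>multi_idx K n \<times> multi_idx K n.
    c lm * (\<Prod>k<n. line_weight K (fst lm k) (snd lm k))
      * (\<Prod>i<n * (K + 1). z i ^ line_index K n lm i))"
proof -
  let ?S = "{..<n} \<rightarrow>\<^sub>E {..<K + 1}" and ?I = "multi_idx K n \<times> multi_idx K n"
  have K0: "K > 0" using K by (simp add: prime_gt_0_nat)
  define q where "q k s l m = (\<Sum>i<K. \<Sum>j<K. cnj (eigvec K s (z (k * (K + 1) + s)) i)
      * site K l m i j * eigvec K s (z (k * (K + 1) + s)) j)" for k s l m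
  have "cyclic_symbol K n A z
      = (\<Sum>s\<in>?S. \<Sum>lm\<in>?I. c lm * (\<Prod>k<n. q k (s k) (fst lm k) (snd lm k))) / of_nat (K + 1) ^ n"
    unfolding cyclic_symbol_def hw_expansion_form[OF A] product_vec_form[OF K0] q_def
    by (simp add: case_prod_beta)
  also have "\<dots> = (\<Sum>lm\<in>?I. c lm * ((\<Sum>s\<in>?S. \<Prod>k<n. q k (s k) (fst lm k) (snd lm k))
      / of_nat (K + 1) ^ n))"
    by (subst sum.swap) (simp add: sum_distrib_left sum_divide_distrib)
  also have "\<dots> = (\<Sum>lm\<in>?I. c lm * (\<Prod>k<n. line_weight K (fst lm k) (snd lm k))
      * (\<Prod>i<n * (K + 1). z i ^ line_index K n lm i))"
  proof (rule sum.cong[OF refl])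
    fix lm assume lm: "lm \<in> ?I"
    have "(\<Sum>s\<in>?S. \<Prod>k<n. q k (s k) (fst lm k) (snd lm k))
        = (\<Prod>k<n. \<Sum>s<K + 1. q k s (fst lm k) (snd lm k))"
      by (rule prod_sum_PiE[symmetric]) auto
    then have "(\<Sum>s\<in>?S. \<Prod>k<n. q k (s k) (fst lm k) (snd lm k)) / of_nat (K + 1) ^ n
        = (\<Prod>k<n. (\<Sum>s<K + 1. q k s (fst lm k) (snd lm k)) / of_nat (K + 1))"
      by (simp add: prod_dividef)
    also have "\<dots> = (\<Prod>k<n. line_weight K (fst lm k) (snd lm k)
        * (\<Prod>s<K + 1. z (k * (K + 1) + s) ^ line_index K n lm (k * (K + 1) + s)))"
    proof (rule prod.cong[OF refl])
      fix k assume "k \<in> {..<n}"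
      then have k: "k < n" by simp
      have zO: "z (k * (K + 1) + s) \<in> Omega K" if "s \<le> K" for s
        using z block_index_less[OF k, of s "K + 1"] that
        unfolding Omega_pow_def by (auto simp: PiE_def Pi_def)
      note b = multi_idx_pair_less[OF lm k]
      have "(\<Sum>s<K + 1. q k s (fst lm k) (snd lm k)) / of_nat (K + 1)
          = line_weight K (fst lm k) (snd lm k)
            * (\<Prod>s<K + 1. z (k * (K + 1) + s) ^ line_exponent K (fst lm k) (snd lm k) s)"
        unfolding q_def by (rule averaged_eigvec_form[OF K b zO])
      also have "(\<Prod>s<K + 1. z (k * (K + 1) + s) ^ line_exponent K (fst lm k) (snd lm k) s)
          = (\<Prod>s<K + 1. z (k * (K + 1) + s) ^ line_index K n lm (k * (K + 1) + s))"
        using line_index_block[OF k, of _ K lm] by (intro prod.cong refl) simp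
      finally show "(\<Sum>s<K + 1. q k s (fst lm k) (snd lm k)) / of_nat (K + 1)
          = line_weight K (fst lm k) (snd lm k)
            * (\<Prod>s<K + 1. z (k * (K + 1) + s) ^ line_index K n lm (k * (K + 1) + s))" .
    qed
    also have "\<dots> = (\<Prod>k<n. line_weight K (fst lm k) (snd lm k))
        * (\<Prod>i<n * (K + 1). z i ^ line_index K n lm i)"
      by (simp only: prod.distrib prod_blocks)
    finally show "c lm * ((\<Sum>s\<in>?S. \<Prod>k<n. q k (s k) (fst lm k) (snd lm k)) / of_nat (K + 1) ^ n)
        = c lm * (\<Prod>k<n. line_weight K (fst lm k) (snd lm k))
          * (\<Prod>i<n * (K + 1). z i ^ line_index K n lm i)"
      by (simp only: mult.assoc)
  qed
  finally show ?thesis .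
qed

lemma line_index_in:
  assumes K: "prime K" and lm: "lm \<in> multi_idx K n \<times> multi_idx K n"
  shows "line_index K n lm \<in> multi_idx K (n * (K + 1))"
proof -
  have "line_index K n lm i < K" if "i < n * (K + 1)" for i
  proof -
    have "i div (K + 1) < n" using that by (rule less_mult_imp_div_less)
    note b = multi_idx_pair_less[OF lm this]
    have "line_exponent K (fst lm (i div (K + 1))) (snd lm (i div (K + 1))) s < K" for s
      using b by (simp only: line_exponent_def line_coord_def) auto
    then show ?thesis using that by (simp only: line_index_def restrict_apply lessThan_iff if_True)
  qed
  moreover have "line_index K n lm \<in> extensional {..<n * (K + 1)}"
    unfolding line_index_def by (rule restrict_extensional)
  ultimately show ?thesis by (auto simp only: multi_idx_def PiE_iff lessThan_iff)
qed

lemma line_index_inj: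
  assumes K: "prime K"
  shows "inj_on (line_index K n) (multi_idx K n \<times> multi_idx K n)"
proof (rule inj_onI)
  fix a b assume a: "a \<in> multi_idx K n \<times> multi_idx K n" and b: "b \<in> multi_idx K n \<times> multi_idx K n"
    and eq: "line_index K n a = line_index K n b"
  have "fst a k = fst b k \<and> snd a k = snd b k" if k: "k < n" for k
  proof (rule line_exponent_inj[OF K multi_idx_pair_less[OF a k] multi_idx_pair_less[OF b k]])
    show "line_exponent K (fst a k) (snd a k) s = line_exponent K (fst b k) (snd b k) s"
      if "s < K + 1" for s
      using eq line_index_block[OF k that, of a] line_index_block[OF k that, of b] by simp
  qed
  then have agree: "\<forall>k<n. fst a k = fst b k" "\<forall>k<n. snd a k = snd b k" by blast+
  have "fst a \<in> {..<n} \<rightarrow>\<^sub>E {..<K}" "fst b \<in> {..<n} \<rightarrow>\<^sub>E {..<K}"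
    "snd a \<in> {..<n} \<rightarrow>\<^sub>E {..<K}" "snd b \<in> {..<n} \<rightarrow>\<^sub>E {..<K}"
    using a b by (simp_all only: multi_idx_def mem_Times_iff)
  then have "fst a = fst b" "snd a = snd b"
    using agree by (simp_all only: PiE_eq_iff_lt)
  then show "a = b" by (rule prod_eqI)
qed

lemma sum_line_index_le:
  assumes K: "prime K" and lm: "lm \<in> multi_idx K n \<times> multi_idx K n"
  shows "(\<Sum>i<n * (K + 1). line_index K n lm i) \<le> (\<Sum>k<n. fst lm k + snd lm k)"
proof -
  have "(\<Sum>i<n * (K + 1). line_index K n lm i)
      = (\<Sum>k<n. \<Sum>s<K + 1. line_index K n lm (k * (K + 1) + s))"
    by (rule sum_blocks)
  also have "\<dots> = (\<Sum>k<n. \<Sum>s<K + 1. line_exponent K (fst lm k) (snd lm k) s)"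
  proof (rule sum.cong[OF refl], rule sum.cong[OF refl])
    fix k s assume "k \<in> {..<n}" "s \<in> {..<K + 1}"
    then have "k < n" "s < K + 1" by (simp_all only: lessThan_iff)
    then show "line_index K n lm (k * (K + 1) + s) = line_exponent K (fst lm k) (snd lm k) s"
      by (rule line_index_block)
  qed
  also have "\<dots> \<le> (\<Sum>k<n. fst lm k + snd lm k)"
  proof (rule sum_mono)
    fix k
    have "(\<Sum>s<K + 1. line_exponent K (fst lm k) (snd lm k) s) \<le> line_coord (fst lm k) (snd lm k)"
      by (simp add: line_exponent_def)
    then show "(\<Sum>s<K + 1. line_exponent K (fst lm k) (snd lm k) s) \<le> fst lm k + snd lm k"
      by (auto simp: line_coord_def split: if_splits)
  qed
  finally show ?thesis .
qed

text \<open>Since \<open>line_index\<close> is injective, the monomials in \<open>cyclic_symbol_eq\<close> are distinct, and the coefficients can be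
  read off.\<close>

lemma cyclic_coeff_cyclic_symbol:
  fixes K n :: nat and A :: "complex mat"
  defines "I \<equiv> multi_idx K n \<times> multi_idx K n"
    and "h \<equiv> \<lambda>lm. hw_coeff K n A lm * (\<Prod>k<n. line_weight K (fst lm k) (snd lm k))"
  assumes K: "prime K" and A: "A \<in> carrier_mat (K ^ n) (K ^ n)"
  shows "cyclic_coeff K (n * (K + 1)) (cyclic_symbol K n A)
    = (\<lambda>\<alpha>. if \<alpha> \<in> line_index K n ` I then h (the_inv_into I (line_index K n) \<alpha>) else 0)"
    (is "_ = ?c")
proof -
  have K0: "K > 0" using K by (simp add: prime_gt_0_nat)
  have inj: "inj_on (line_index K n) I" unfolding I_def by (rule line_index_inj[OF K])
  have sub: "line_index K n ` I \<subseteq> multi_idx K (n * (K + 1))"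
    using line_index_in[OF K] unfolding I_def by blast
  have on: "?c (line_index K n lm) = h lm" if "lm \<in> I" for lm
    using that by (simp only: the_inv_into_f_f[OF inj] imageI if_True)
  have off: "?c \<alpha> = 0" if "\<alpha> \<notin> line_index K n ` I" for \<alpha>
    using that by (rule if_not_P)
  show ?thesis
  proof (rule cyclic_coeff_eqI[OF K0])
    show "cyclic_expansion K (n * (K + 1)) (cyclic_symbol K n A) ?c"
      unfolding cyclic_expansion_def
    proof (intro conjI allI impI ballI)
      fix \<alpha> assume "\<alpha> \<notin> multi_idx K (n * (K + 1))"
      then show "?c \<alpha> = 0" using sub by (intro off) blast
    next
      fix z assume z: "z \<in> Omega_pow K (n * (K + 1))"
      have "cyclic_symbol K n A z
          = (\<Sum>lm\<in>I. h lm * (\<Prod>i<n * (K + 1). z i ^ line_index K n lm i))"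
        unfolding h_def I_def by (rule cyclic_symbol_eq[OF K hw_expansion_coeff[OF K0 A] z])
      also have "\<dots> = (\<Sum>\<alpha>\<in>line_index K n ` I. ?c \<alpha> * (\<Prod>i<n * (K + 1). z i ^ \<alpha> i))"
        unfolding sum.reindex[OF inj] o_def by (rule sum.cong[OF refl]) (simp only: on)
      also have "\<dots> = (\<Sum>\<alpha>\<in>multi_idx K (n * (K + 1)). ?c \<alpha> * (\<Prod>i<n * (K + 1). z i ^ \<alpha> i))"
        by (rule sum.mono_neutral_left[OF finite_multi_idx sub]) simp
      finally show "cyclic_symbol K n A z
          = (\<Sum>\<alpha>\<in>multi_idx K (n * (K + 1)). ?c \<alpha> * (\<Prod>i<n * (K + 1). z i ^ \<alpha> i))" .
    qed
  qed
qed

lemma cyclic_coeff_line_index: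
  assumes "prime K" "A \<in> carrier_mat (K ^ n) (K ^ n)" and lm: "lm \<in> multi_idx K n \<times> multi_idx K n"
  shows "cyclic_coeff K (n * (K + 1)) (cyclic_symbol K n A) (line_index K n lm)
    = hw_coeff K n A lm * (\<Prod>k<n. line_weight K (fst lm k) (snd lm k))"
  unfolding cyclic_coeff_cyclic_symbol[OF assms(1,2)]
  by (simp only: the_inv_into_f_f[OF line_index_inj[OF assms(1)] lm] imageI[OF lm] if_True)

lemma cyclic_coeff_off_lines:
  assumes "prime K" "A \<in> carrier_mat (K ^ n) (K ^ n)"
    and "\<alpha> \<notin> line_index K n ` (multi_idx K n \<times> multi_idx K n)"
  shows "cyclic_coeff K (n * (K + 1)) (cyclic_symbol K n A) \<alpha> = 0"
  unfolding cyclic_coeff_cyclic_symbol[OF assms(1,2)] using assms(3) by (rule if_not_P)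

lemma cyclic_symbol_degree_le:
  assumes K: "prime K" and A: "A \<in> carrier_mat (K ^ n) (K ^ n)" and deg: "hw_degree_le K n d A"
  shows "cyclic_degree_le K (n * (K + 1)) d (cyclic_symbol K n A)"
  unfolding cyclic_degree_le_def
proof (intro ballI impI)
  fix \<alpha> assume big: "(\<Sum>j<n * (K + 1). \<alpha> j) > d"
  show "cyclic_coeff K (n * (K + 1)) (cyclic_symbol K n A) \<alpha> = 0"
  proof (cases "\<alpha> \<in> line_index K n ` (multi_idx K n \<times> multi_idx K n)")
    case True
    then obtain lm where lm: "lm \<in> multi_idx K n \<times> multi_idx K n" "\<alpha> = line_index K n lm" by blast
    have "d < (\<Sum>k<n. fst lm k + snd lm k)"
      using big[unfolded lm(2)] sum_line_index_le[OF K lm(1)] by (rule less_le_trans)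
    then have "hw_coeff K n A (fst lm, snd lm) = 0"
      using deg lm(1) unfolding hw_degree_le_def mem_Times_iff by blast
    then have "hw_coeff K n A lm = 0" by simp
    then show ?thesis
      unfolding lm(2) cyclic_coeff_line_index[OF K A lm(1)] by (simp only: mult_zero_left)
  qed (rule cyclic_coeff_off_lines[OF K A])
qed

text \<open>The product of the \<open>line_weight\<close>s has modulus at least \<open>(K + 1)\<close> to the power minus the degree, and the
  degree bound is available wherever the coefficient of \<open>A\<close> is nonzero.\<close>

lemma BH_norm_hw_coeff_le:
  assumes K: "prime K" and A: "A \<in> carrier_mat (K ^ n) (K ^ n)" and d: "d \<ge> 1"
    and deg: "hw_degree_le K n d A"
  shows "BH_norm d (multi_idx K n \<times> multi_idx K n) (hw_coeff K n A)
    \<le> (real K + 1) ^ d *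
      BH_norm d (multi_idx K (n * (K + 1))) (cyclic_coeff K (n * (K + 1)) (cyclic_symbol K n A))"
proof (rule BH_norm_reindex_le[OF d, where h = "line_index K n"])
  fix lm assume lm: "lm \<in> multi_idx K n \<times> multi_idx K n"
  let ?W = "\<Prod>k<n. line_weight K (fst lm k) (snd lm k)"
  have "cmod (hw_coeff K n A lm) \<le> (real K + 1) ^ d * (cmod (hw_coeff K n A lm) * cmod ?W)"
  proof (cases "hw_coeff K n A lm = 0")
    case False
    have le: "(\<Sum>k<n. fst lm k + snd lm k) \<le> d"
    proof (rule ccontr)
      assume "\<not> ?thesis"
      then have "d < (\<Sum>k<n. fst lm k + snd lm k)" by simp
      then have "hw_coeff K n A (fst lm, snd lm) = 0"
        using deg lm unfolding hw_degree_le_def mem_Times_iff by blast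
      then show False using False by simp
    qed
    have "(1 / real (K + 1)) ^ d \<le> (1 / real (K + 1)) ^ (\<Sum>k<n. fst lm k + snd lm k)"
      by (rule power_decreasing[OF le]) auto
    also have "\<dots> = (\<Prod>k<n. (1 / real (K + 1)) ^ (fst lm k + snd lm k))"
      by (rule power_sum)
    also have "\<dots> \<le> (\<Prod>k<n. cmod (line_weight K (fst lm k) (snd lm k)))"
      by (intro prod_mono conjI norm_line_weight_ge) auto
    also have "\<dots> = cmod ?W" by (simp add: prod_norm)
    finally have "1 \<le> (real K + 1) ^ d * cmod ?W"
      by (simp add: power_one_over field_simps)
    then have "cmod (hw_coeff K n A lm) * 1 \<le> cmod (hw_coeff K n A lm) * ((real K + 1) ^ d * cmod ?W)"
      by (rule mult_left_mono) simp
    then show ?thesis by (simp add: mult_ac)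
  qed simp
  then show "cmod (hw_coeff K n A lm) \<le> (real K + 1) ^ d *
      cmod (cyclic_coeff K (n * (K + 1)) (cyclic_symbol K n A) (line_index K n lm))"
    by (simp only: cyclic_coeff_line_index[OF K A lm] norm_mult)
next
  show "line_index K n ` (multi_idx K n \<times> multi_idx K n) \<subseteq> multi_idx K (n * (K + 1))"
    using line_index_in[OF K] by blast
qed (simp_all add: line_index_inj[OF K])

lemma cyclic_coeff_eq_0:
  assumes "K > 0" and "\<And>z. z \<in> Omega_pow K N \<Longrightarrow> f z = 0"
  shows "cyclic_coeff K N f = (\<lambda>_. 0)"
  by (rule cyclic_coeff_eqI[OF assms(1)]) (simp add: cyclic_expansion_def assms(2))

lemma Omega_pow_nonempty: "K > 0 \<Longrightarrow> Omega_pow K N \<noteq> {}"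
  by (auto simp: Omega_pow_def PiE_eq_empty_iff Omega_def)

theorem theorem6:
  fixes K d :: nat
  assumes "prime K" and "d \<ge> 1"
  shows "\<exists>C::ennreal. C \<le> ennreal ((real K + 1) ^ d) * BH_cyclic K d \<and>
    (\<forall>n\<ge>1. \<forall>A. observable K n A \<and> hw_degree_le K n d A \<longrightarrow>
      ennreal (BH_norm d (multi_idx K n \<times> multi_idx K n) (hw_coeff K n A)) \<le> C * ennreal (op_norm A))"
proof (rule exI[of _ "ennreal ((real K + 1) ^ d) * BH_cyclic K d"], intro conjI allI impI)
  fix n :: nat and A
  assume n: "n \<ge> 1" and obs: "observable K n A \<and> hw_degree_le K n d A"
  then have A: "A \<in> carrier_mat (K ^ n) (K ^ n)" and deg: "hw_degree_le K n d A"
    by (auto simp: observable_def)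
  have K0: "K > 0" using assms(1) by (simp add: prime_gt_0_nat)
  define N where "N = n * (K + 1)"
  define f where "f = cyclic_symbol K n A"
  define b where "b = BH_norm d (multi_idx K n \<times> multi_idx K n) (hw_coeff K n A)"
  define M where "M = (real K + 1) ^ d"
  have N1: "N \<ge> 1" using n by (simp add: N_def)
  have M0: "M > 0" by (simp add: M_def)
  have b_le: "b \<le> M * BH_norm d (multi_idx K N) (cyclic_coeff K N f)"
    unfolding b_def M_def N_def f_def by (rule BH_norm_hw_coeff_le[OF assms(1) A assms(2) deg])
  have f_le: "cmod (f z) \<le> op_norm A" if "z \<in> Omega_pow K N" for z
    using norm_cyclic_symbol_le[OF K0 A] that by (simp add: f_def N_def)
  have op0: "op_norm A \<ge> 0"
    using f_le Omega_pow_nonempty[OF K0, of N] by (meson ex_in_conv norm_ge_zero order_trans)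
  have "ennreal b \<le> ennreal M * BH_cyclic K d * ennreal (op_norm A)"
  proof (cases "op_norm A = 0")
    case True
    \<comment> \<open>The right-hand side is zero here even if \<open>BH_cyclic K d\<close> were \<open>\<infinity>\<close>, so the case needs \<open>A\<close> to have
      no nonzero coefficient.\<close>
    then have "cyclic_coeff K N f = (\<lambda>_. 0)"
      using f_le by (intro cyclic_coeff_eq_0[OF K0]) fastforce
    then have "b \<le> 0" using b_le by (simp add: BH_norm_def)
    then show ?thesis by (simp add: ennreal_neg)
  next
    case False
    define r where "r = M * op_norm A"
    have r: "r > 0" using False op0 M0 by (simp add: r_def)
    \<comment> \<open>Dividing by \<open>r\<close> lets the bound pass to the infimum over \<open>C\<close>. A negative \<open>C\<close> is covered by
      \<open>max 0 C\<close>, which has the same image in \<open>ennreal\<close>.\<close>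
    have "ennreal (b / r) \<le> ennreal C" if C: "BH_bound K d C" for C
    proof -
      have "BH_norm d (multi_idx K N) (cyclic_coeff K N f) \<le> C * (SUP z\<in>Omega_pow K N. cmod (f z))"
        using C N1 cyclic_symbol_degree_le[OF assms(1) A deg]
        unfolding BH_bound_def N_def f_def by blast
      also have "\<dots> \<le> max 0 C * (SUP z\<in>Omega_pow K N. cmod (f z))"
      proof (rule mult_right_mono)
        obtain z where z: "z \<in> Omega_pow K N" using Omega_pow_nonempty[OF K0] by blast
        have "cmod (f z) \<le> (SUP z\<in>Omega_pow K N. cmod (f z))" by (rule cSUP_upper[OF z]) simp
        then show "0 \<le> (SUP z\<in>Omega_pow K N. cmod (f z))" by (rule order_trans[rotated]) simp
      qed simp
      also have "\<dots> \<le> max 0 C * op_norm A"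
        by (intro mult_left_mono cSUP_least Omega_pow_nonempty[OF K0] f_le) auto
      finally have "b \<le> M * (max 0 C * op_norm A)"
        using b_le M0 by (meson less_imp_le mult_left_mono order_trans)
      then have "b / r \<le> max 0 C" using r by (simp add: r_def pos_divide_le_eq mult_ac)
      then have "ennreal (b / r) \<le> ennreal (max 0 C)" by (rule ennreal_leI)
      then show ?thesis by (simp add: max_def ennreal_neg split: if_splits)
    qed
    then have "ennreal (b / r) \<le> BH_cyclic K d"
      unfolding BH_cyclic_def by (intro INF_greatest) simp
    then have "ennreal r * ennreal (b / r) \<le> ennreal r * BH_cyclic K d"
      by (rule mult_left_mono) simp
    moreover have "ennreal r * ennreal (b / r) = ennreal b"
      using r by (subst ennreal_mult[symmetric]) (auto simp: b_def BH_norm_nonneg)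
    moreover have "ennreal r = ennreal M * ennreal (op_norm A)"
      unfolding r_def using M0 op0 by (simp add: ennreal_mult)
    ultimately show ?thesis by (simp add: mult_ac)
  qed
  then show "ennreal (BH_norm d (multi_idx K n \<times> multi_idx K n) (hw_coeff K n A))
      \<le> ennreal ((real K + 1) ^ d) * BH_cyclic K d * ennreal (op_norm A)"
    by (simp only: b_def M_def)
qed simp

end
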